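(* Let $h\geq 2$ and $r\geq 2$ be integers, and let $F_{1},F_{2},\dots,F_{h}$ be vertex-critical graphs with $\chi(F_{i})=r+1\geq 3$ for every $1\leq i\leq h$, such that $F_{1},F_{2},\dots,F_{h}$ is properly ordered. Then, for all sufficiently large $n$, $$\mathrm{ex}\Big(n,\bigcup_{1\leq i\leq h}F_{i}\Big)=\max_{1\leq \ell\leq h}\left\{\binom{\ell-1}{2}+(\ell-1)(n-\ell+1)+\mathrm{ex}(n-\ell+1,F_{\ell})\right\}.$$ Moreover, every graph in $\mathrm{EX}(n,\bigcup_{1\leq i\leq h}F_{i})$ is of the form $K_{\ell-1}\prod H$ for some $1\leq \ell\leq h$, where $H\in \mathrm{EX}(n-\ell+1,F_{\ell})$.
   Context: All graphs are finite, simple and undirected; $\chi(G)$ is the chromatic number. For a graph $F$, a graph $G$ is $F$-free if it contains no subgraph isomorphic to $F$; $\mathrm{EX}(n,F)$ is the set of $F$-free graphs on $n$ vertices with the maximum possible number of edges, and $\mathrm{ex}(n,F)$ is the number of edges of any graph in $\mathrm{EX}(n,F)$. A graph $F$ is vertex-critical if there is a vertex $u$ of $F$ with $\chi(F-u)=\chi(F)-1$. $\bigcup_{1\leq i\leq h}F_{i}$ denotes the vertex-disjoint union of $F_1,\dots,F_h$. For graphs $G_1,G_2$, $G_1\prod G_2$ denotes the join: the disjoint union of $G_1$ and $G_2$ together with all edges between $V(G_1)$ and $V(G_2)$; $K_{0}\prod H$ means $H$. $K_m$ is the complete graph on $m$ vertices, and $\binom{a}{2}=0$ for $a\in\{0,1\}$.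 Graphs $F_{1},\dots,F_{h}$, all with chromatic number $r+1\geq 3$, are called properly ordered if for every (sufficiently large) number of vertices $N$ and every $1\leq \ell\leq h$, there exists at least one graph in $\mathrm{EX}(N,F_{\ell})$ that contains no copy of any $F_{j}$ with $1\leq j\leq \ell$. *)

theory Defs
  imports Complex_Main
begin

text \<open>
  A graph is a vertex set with a set of two-element edges; \<open>simple_graph\<close> is the well-formedness
  condition. The vertices may come from any type.
\<close>

record 'a graph =
  verts :: "'a set"
  edges :: "'a set set"

definition simple_graph :: "'a graph \<Rightarrow> bool" where
  "simple_graph G \<longleftrightarrow> finite (verts G) \<and> (\<forall>e\<in>edges G. e \<subseteq> verts G \<and> card e = 2)"

definition subgraph :: "'a graph \<Rightarrow> 'a graph \<Rightarrow> bool" where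
  "subgraph S G \<longleftrightarrow> simple_graph S \<and> verts S \<subseteq> verts G \<and> edges S \<subseteq> edges G"

definition graph_iso :: "'a graph \<Rightarrow> 'b graph \<Rightarrow> bool" where
  "graph_iso G H \<longleftrightarrow>
     (\<exists>f. bij_betw f (verts G) (verts H) \<and> (\<lambda>e. f ` e) ` edges G = edges H)"

definition graph_free :: "'f graph \<Rightarrow> 'a graph \<Rightarrow> bool" where
  "graph_free F G \<longleftrightarrow> \<not> (\<exists>S. subgraph S G \<and> graph_iso S F)"

definition proper_colouring :: "'a graph \<Rightarrow> nat \<Rightarrow> ('a \<Rightarrow> nat) \<Rightarrow> bool" where
  "proper_colouring G k c \<longleftrightarrow>
     c ` verts G \<subseteq> {..<k} \<and> (\<forall>u v. {u, v} \<in> edges G \<longrightarrow> c u \<noteq> c v)"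

definition chromatic_number :: "'a graph \<Rightarrow> nat" where
  "chromatic_number G = (LEAST k. \<exists>c. proper_colouring G k c)"

definition delete_vertex :: "'a graph \<Rightarrow> 'a \<Rightarrow> 'a graph" where
  "delete_vertex G u = \<lparr>verts = verts G - {u}, edges = {e \<in> edges G. u \<notin> e}\<rparr>"

definition vertex_critical :: "'a graph \<Rightarrow> bool" where
  "vertex_critical F \<longleftrightarrow>
     (\<exists>u\<in>verts F. chromatic_number (delete_vertex F u) = chromatic_number F - 1)"

text \<open>
  Every graph on \<open>n\<close> vertices has an isomorphic copy with natural numbers as vertices, so it
  suffices to maximise over those; this keeps \<open>ex_number\<close> independent of the vertex type of
  the graphs collected in \<open>extremal_graphs\<close>. The maximum is over a finite set, which is nonempty
  as soon as \<open>F\<close> has an edge.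
\<close>

definition ex_number :: "nat \<Rightarrow> 'f graph \<Rightarrow> nat" where
  "ex_number n F =
     Max {card (edges G) | G :: nat graph. simple_graph G \<and> card (verts G) = n \<and> graph_free F G}"

definition extremal_graphs :: "nat \<Rightarrow> 'f graph \<Rightarrow> 'a graph set" where
  "extremal_graphs n F =
     {G. simple_graph G \<and> card (verts G) = n \<and> graph_free F G \<and> card (edges G) = ex_number n F}"

definition disjoint_union :: "'i set \<Rightarrow> ('i \<Rightarrow> 'f graph) \<Rightarrow> ('i \<times> 'f) graph" where
  "disjoint_union I F =
     \<lparr>verts = (SIGMA i:I. verts (F i)), edges = (\<Union>i\<in>I. (\<lambda>e. Pair i ` e) ` edges (F i))\<rparr>"

definition graph_join :: "'a graph \<Rightarrow> 'b graph \<Rightarrow> ('a + 'b) graph" where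
  "graph_join G H =
     \<lparr>verts = verts G <+> verts H,
      edges = (\<lambda>e. Inl ` e) ` edges G \<union> (\<lambda>e. Inr ` e) ` edges H
                \<union> {{Inl u, Inr v} | u v. u \<in> verts G \<and> v \<in> verts H}\<rparr>"

definition complete_graph :: "nat \<Rightarrow> nat graph" where
  "complete_graph m = \<lparr>verts = {..<m}, edges = {e. e \<subseteq> {..<m} \<and> card e = 2}\<rparr>"

definition properly_ordered :: "nat \<Rightarrow> (nat \<Rightarrow> 'f graph) \<Rightarrow> bool" where
  "properly_ordered h F \<longleftrightarrow>
     (\<forall>\<^sub>F N in sequentially. \<forall>l\<in>{1..h}.
        \<exists>G :: nat graph. G \<in> extremal_graphs N (F l) \<and> (\<forall>j\<in>{1..l}. graph_free (F j) G))"

end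

theory Submission
  imports Defs
begin

text \<open>
  Let \<open>t\<close> bound the orders of the \<open>F i\<close>. Deleting a critical vertex leaves an \<open>r\<close>-colourable graph, so
  each \<open>F i\<close> embeds into a vertex joined to \<open>K\<^sub>r(t)\<close>. In a dense graph \<open>G\<close> without the disjoint union,
  the neighbourhood of every vertex of degree at least \<open>(1 - 1/r + \<epsilon>)n\<close> contains \<open>K\<^sub>r(t)\<close> even after a
  bounded number of deletions, so such a vertex can host any one of the \<open>F i\<close>. Let \<open>W\<close> be the set
  of these vertices and \<open>s = |W|\<close>; then \<open>s < h\<close>.

  If \<open>G - W\<close> contains \<open>F (s + 1)\<close>, take a maximal subfamily containing \<open>s + 1\<close> that packs disjointly
  into \<open>G - W\<close>. It has fewer than \<open>h - s\<close> members, hence misses some \<open>j \<ge> s + 2\<close>, and deleting the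
  boundedly many vertices it covers leaves an \<open>F j\<close>-free graph. Since \<open>ex(N + 1, F j) - ex(N, F j)\<close> is
  at least \<open>(1 - 1/r - \<epsilon>)N\<close> and \<open>ex(N, F j) \<le> ex(N, F (s + 2))\<close> by the ordering, \<open>G\<close> then has about
  \<open>n/r\<close> edges fewer than the lower bound construction with \<open>s + 1\<close> full vertices. So for a \<open>G\<close> with at
  least as many edges as that construction, \<open>G - W\<close> is \<open>F (s + 1)\<close>-free, and counting edges at \<open>W\<close>
  yields the theorem.
\<close>

section \<open>Degrees and edge counts\<close>

text \<open>The two edge counts compared at the end differ only by order n, so knowing
  \<open>ex_number\<close> up to o(n^2) is too coarse. What is needed is its increment from N to N +
  1, and criticality supplies it. Deleting the x vertices covered by the packing costs at most x(1 -
  1/r + \<epsilon>)n edges, because they lie outside W. The construction with s + 1 full vertices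
  regains x - 1 increments of about (1 - 1/r)n and one vertex of degree about n. The net difference
  is n/r - (2x - 1)\<epsilon>n up to a constant, and as x \<le> t, the choice \<epsilon> = 1/(4tr)
  preserves n/(2r) of it. The index s + 1 is forced into the subfamily for two reasons: it gives x
  \<ge> 1, so that the extra full vertex takes the place of a covered one, and since more than s
  indices are missing, one of them exceeds s + 1. The ordering enters twice: in the monotonicity of
  \<open>ex_number\<close> along the family, and in the lower bound, where the graph joined to the
  clique on l - 1 vertices must omit all of \<open>F 1\<close>, ..., \<open>F l\<close> for a
  pigeonhole argument.\<close>

definition nbrs :: "'a graph \<Rightarrow> 'a \<Rightarrow> 'a set" where
  "nbrs G x = {y. {x, y} \<in> edges G}"

definition edges_in :: "'a graph \<Rightarrow> 'a set \<Rightarrow> 'a set set" where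
  "edges_in G A = {e \<in> edges G. e \<subseteq> A}"

lemma nbrs_sym: "y \<in> nbrs G x \<longleftrightarrow> x \<in> nbrs G y"
  by (simp add: nbrs_def insert_commute)

lemma finite_edges: "simple_graph G \<Longrightarrow> finite (edges G)"
  by (rule finite_subset[of _ "Pow (verts G)"]) (auto simp: simple_graph_def)

lemma finite_edges_in: "simple_graph G \<Longrightarrow> finite (edges_in G A)"
  using finite_edges[of G] by (simp add: edges_in_def)

lemma edges_in_verts: "simple_graph G \<Longrightarrow> edges_in G (verts G) = edges G"
  by (auto simp: edges_in_def simple_graph_def)

lemma nbrs_irrefl: "simple_graph G \<Longrightarrow> x \<notin> nbrs G x"
  by (auto simp: nbrs_def simple_graph_def)

lemma card_edges_in_remove:
  assumes "simple_graph G" "finite A" "v \<in> A"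
  shows "card (edges_in G A) = card (edges_in G (A - {v})) + card (nbrs G v \<inter> A)"
proof -
  let ?f = "\<lambda>y. {v, y}"
  have eq: "edges_in G A = edges_in G (A - {v}) \<union> ?f ` (nbrs G v \<inter> A)" (is "?L = ?R")
  proof
    show "?L \<subseteq> ?R"
    proof
      fix e assume e: "e \<in> ?L"
      show "e \<in> ?R"
      proof (cases "v \<in> e")
        case False
        then show ?thesis using e by (auto simp: edges_in_def)
      next
        case True
        have "card e = 2" using e assms(1) by (auto simp: edges_in_def simple_graph_def)
        then obtain y where "e = {v, y}"
          using True by (auto simp: card_2_iff)
        then show ?thesis using e by (auto simp: edges_in_def nbrs_def)
      qed
    qed
    show "?R \<subseteq> ?L" using assms(3) by (auto simp: edges_in_def nbrs_def)
  qed
  have "inj_on ?f (nbrs G v \<inter> A)"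
    by (auto simp: inj_on_def doubleton_eq_iff)
  moreover have "edges_in G (A - {v}) \<inter> ?f ` (nbrs G v \<inter> A) = {}"
    by (auto simp: edges_in_def)
  ultimately show ?thesis
    using finite_edges_in[OF assms(1)] assms(2)
    by (simp add: eq card_Un_disjoint card_image)
qed

lemma card_edges_in_le_square:
  assumes "simple_graph G" "finite A"
  shows "2 * card (edges_in G A) \<le> (card A)\<^sup>2"
  using assms(2)
proof (induction A rule: finite_induct)
  case empty
  have "edges_in G {} = {}" using assms(1) by (auto simp: edges_in_def simple_graph_def)
  then show ?case by simp
next
  case (insert v A)
  have "card (nbrs G v \<inter> insert v A) \<le> card A"
    using nbrs_irrefl[OF assms(1), of v] insert by (intro card_mono) auto
  with card_edges_in_remove[OF assms(1), of "insert v A" v] insert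
  show ?case by (simp add: power2_eq_square)
qed

text \<open>Removing \<open>X\<close> vertex by vertex never raises a degree inside the remaining
  set, so the bound \<open>D\<close> stays valid throughout.\<close>

lemma card_edges_in_Diff_le:
  fixes D :: real
  assumes "simple_graph G" "finite A" "X \<subseteq> A"
    and "\<And>x. x \<in> X \<Longrightarrow> card (nbrs G x \<inter> A) \<le> D"
  shows "card (edges_in G A) \<le> card (edges_in G (A - X)) + card X * D"
proof -
  have "finite X" using assms(2,3) finite_subset by blast
  then show ?thesis using assms(3,4)
  proof (induction X rule: finite_induct)
    case empty
    then show ?case by simp
  next
    case (insert x X)
    have "card (edges_in G (A - X)) = card (edges_in G (A - insert x X)) + card (nbrs G x \<inter> (A - X))"
      using card_edges_in_remove[OF assms(1), of "A - X" x] insert assms(2)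
      by (simp add: Diff_insert[of A x X])
    moreover have "card (nbrs G x \<inter> (A - X)) \<le> card (nbrs G x \<inter> A)"
      using assms(2) by (intro card_mono) auto
    moreover have "card (nbrs G x \<inter> A) \<le> D" using insert by auto
    ultimately have "card (edges_in G (A - X)) \<le> card (edges_in G (A - insert x X)) + D"
      by linarith
    moreover have "card (edges_in G A) \<le> card (edges_in G (A - X)) + card X * D"
      using insert by auto
    ultimately show ?case using insert by (simp add: algebra_simps)
  qed
qed

lemma card_Int_eq_sum: "finite A \<Longrightarrow> card (N \<inter> A) = (\<Sum>x\<in>A. if x \<in> N then 1 else 0)"
  by (simp add: sum.If_cases Int_commute)

lemma sum_card_nbrs_swap:
  assumes "finite S" "finite A"
  shows "(\<Sum>s\<in>S. card (nbrs G s \<inter> A)) = (\<Sum>x\<in>A. card (nbrs G x \<inter> S))"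
proof -
  have "(\<Sum>s\<in>S. card (nbrs G s \<inter> A)) = (\<Sum>s\<in>S. \<Sum>x\<in>A. if x \<in> nbrs G s then 1 else 0)"
    using assms by (simp only: card_Int_eq_sum)
  also have "\<dots> = (\<Sum>x\<in>A. \<Sum>s\<in>S. if s \<in> nbrs G x then 1 else 0)"
    by (subst sum.swap, subst nbrs_sym) (rule refl)
  also have "\<dots> = (\<Sum>x\<in>A. card (nbrs G x \<inter> S))"
    using assms by (simp only: card_Int_eq_sum)
  finally show ?thesis .
qed

text \<open>A maximiser of \<open>e(A) - c|A|\<^sup>2/2\<close> cannot gain by losing a vertex.\<close>

lemma exists_subset_min_degree:
  fixes c :: real
  assumes "simple_graph G" "finite V"
  shows "\<exists>A\<subseteq>V. (\<forall>v\<in>A. c * (card A - 1/2) \<le> card (nbrs G v \<inter> A)) \<and>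
           card (edges_in G V) - c * (card V)\<^sup>2 / 2 \<le> card (edges_in G A) - c * (card A)\<^sup>2 / 2"
proof -
  define \<phi> where "\<phi> A = card (edges_in G A) - c * (card A)\<^sup>2 / 2" for A
  have fin: "finite (\<phi> ` Pow V)" using assms(2) by simp
  have "Max (\<phi> ` Pow V) \<in> \<phi> ` Pow V" using fin by (intro Max_in) auto
  then obtain A where A: "A \<subseteq> V" "\<phi> A = Max (\<phi> ` Pow V)" by auto
  have max: "\<phi> B \<le> \<phi> A" if "B \<subseteq> V" for B
    using that fin A(2) by (auto intro: Max_ge)
  have finA: "finite A" using A(1) assms(2) finite_subset by blast
  have "c * (card A - 1/2) \<le> card (nbrs G v \<inter> A)" if v: "v \<in> A" for v
  proof -
    have "\<phi> (A - {v}) \<le> \<phi> A" using A(1) by (intro max) auto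
    moreover have "real (card (A - {v})) = real (card A) - 1"
      using card.remove[OF finA v] by simp
    ultimately have "card (edges_in G A) - card (nbrs G v \<inter> A) - c * (real (card A) - 1)\<^sup>2 / 2
        \<le> card (edges_in G A) - c * (card A)\<^sup>2 / 2"
      using card_edges_in_remove[OF assms(1) finA v] by (simp add: \<phi>_def)
    \<comment> \<open>The shift by 1/2 in the degree bound is the difference of the two squares, a^2
      - (a - 1)^2 = 2(a - 1/2).\<close>
    moreover have "c * (real (card A) - 1)\<^sup>2 / 2 = c * (card A)\<^sup>2 / 2 - c * (card A - 1/2)"
      by (simp add: power2_eq_square algebra_simps add_divide_distrib diff_divide_distrib)
    ultimately show ?thesis by linarith
  qed
  moreover have "\<phi> V \<le> \<phi> A" by (rule max) simp
  ultimately show ?thesis using A(1) by (auto simp: \<phi>_def)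
qed

section \<open>Complete multipartite subgraphs\<close>

text \<open>Disjointness of the parts need not be demanded: a common vertex of two parts would give
  an edge \<open>{x, x}\<close>, which a simple graph lacks. Edges inside a part are allowed, since
  copies are not induced.\<close>

definition multipartite_in :: "'a graph \<Rightarrow> nat \<Rightarrow> (nat \<Rightarrow> 'a set) \<Rightarrow> 'a set \<Rightarrow> bool" where
  "multipartite_in G q S A \<longleftrightarrow> (\<forall>i<q. S i \<subseteq> A) \<and>
     (\<forall>i<q. \<forall>j<q. i \<noteq> j \<longrightarrow> (\<forall>x\<in>S i. \<forall>y\<in>S j. {x, y} \<in> edges G))"

definition has_multipartite :: "'a graph \<Rightarrow> nat \<Rightarrow> nat \<Rightarrow> 'a set \<Rightarrow> bool" where
  "has_multipartite G q t A \<longleftrightarrow> (\<exists>S. multipartite_in G q S A \<and> (\<forall>i<q. card (S i) = t))"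

lemma has_multipartite_mono: "has_multipartite G q t A \<Longrightarrow> A \<subseteq> B \<Longrightarrow> has_multipartite G q t B"
  by (auto simp: has_multipartite_def multipartite_in_def intro: order_trans)

lemma sum_le_one_small:
  fixes f :: "nat \<Rightarrow> nat"
  assumes "k < q" "f k \<le> t" "\<And>i. i < q \<Longrightarrow> f i \<le> T"
  shows "(\<Sum>i<q. f i) \<le> (q - 1) * T + t"
proof -
  have "(\<Sum>i<q. f i) = f k + (\<Sum>i\<in>{..<q} - {k}. f i)"
    using assms(1) by (simp add: sum.remove)
  also have "(\<Sum>i\<in>{..<q} - {k}. f i) \<le> of_nat (card ({..<q} - {k})) * T"
    using assms by (intro sum_bounded_above) auto
  finally show ?thesis using assms by simp
qed

text \<open>One step of the Erdos-Stone induction: large parts are traded for one more part. By the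
  degree condition an average vertex of \<open>A\<close> has at least
  \<open>(q - 1) * T + \<epsilon> * q * T\<close> neighbours in the K_q(T), while a vertex with
  fewer than \<open>t\<close> neighbours in some part has at most \<open>(q - 1) * T + t\<close>. As
  \<open>t\<close> is at most half of the surplus, a positive proportion of \<open>A\<close> has
  \<open>t\<close> neighbours in every part, and \<open>t\<close> of these vertices see the same
  subset of the K_q(T).\<close>

lemma extend_multipartite:
  fixes \<epsilon> :: real
  assumes G: "simple_graph G" and "finite A" "q \<ge> 1" "\<epsilon> > 0"
    and deg: "\<And>x. x \<in> A \<Longrightarrow> (1 - 1 / q + \<epsilon>) * card A \<le> card (nbrs G x \<inter> A)"
    and T: "2 * t \<le> \<epsilon> * q * T" "T \<ge> 1"
    and n: "2 * t * 2 ^ (q * T) < \<epsilon> * card A"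
    and K: "has_multipartite G q T A"
  shows "has_multipartite G (Suc q) t A"
proof -
  obtain S where S: "multipartite_in G q S A" "\<And>i. i < q \<Longrightarrow> card (S i) = T"
    using K unfolding has_multipartite_def by blast
  have SA: "S i \<subseteq> A" if "i < q" for i using S(1) that by (auto simp: multipartite_in_def)
  have finS: "finite (S i)" if "i < q" for i using SA[OF that] assms(2) finite_subset by blast
  define n where "n = real (card A)"
  define U where "U = {x \<in> A. \<forall>i<q. t \<le> card (nbrs G x \<inter> S i)}"
  have finU: "finite U" "U \<subseteq> A" using assms(2) by (auto simp: U_def)
  define d where "d x = (\<Sum>i<q. card (nbrs G x \<inter> S i))" for x
  have le_T: "card (nbrs G x \<inter> S i) \<le> T" if "i < q" for x i
    using S(2)[OF that] finS[OF that] by (metis card_mono inf_le2)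
  have "real q * T * ((1 - 1 / q + \<epsilon>) * n) = (\<Sum>i<q. \<Sum>s\<in>S i. (1 - 1 / q + \<epsilon>) * n)"
    using S(2) by simp
  also have "\<dots> \<le> (\<Sum>i<q. \<Sum>s\<in>S i. real (card (nbrs G s \<inter> A)))"
    using deg SA unfolding n_def by (intro sum_mono) auto
  also have "\<dots> = real (\<Sum>i<q. \<Sum>x\<in>A. card (nbrs G x \<inter> S i))"
    using sum_card_nbrs_swap[OF finS assms(2), of _ G] by (simp flip: of_nat_sum)
  also have "\<dots> = (\<Sum>x\<in>A. real (d x))"
    by (subst sum.swap) (simp add: d_def)
  also have "\<dots> \<le> (\<Sum>x\<in>A. (real q - 1) * T + t + (if x \<in> U then real q * T else 0))"
  proof (rule sum_mono)
    fix x assume x: "x \<in> A"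
    show "real (d x) \<le> (real q - 1) * T + t + (if x \<in> U then real q * T else 0)"
    proof (cases "x \<in> U")
      case True
      have "d x \<le> of_nat (card {..<q}) * T"
        unfolding d_def using le_T by (intro sum_bounded_above) auto
      then have "real (d x) \<le> real q * T" by (simp flip: of_nat_mult)
      moreover have "0 \<le> (real q - 1) * T" using assms(3) by simp
      ultimately show ?thesis using True by simp
    next
      case False
      then obtain k where "k < q" "card (nbrs G x \<inter> S k) < t"
        using x by (auto simp: U_def not_le)
      then have "d x \<le> (q - 1) * T + t"
        unfolding d_def using le_T by (intro sum_le_one_small[of k]) auto
      then have "real (d x) \<le> real ((q - 1) * T + t)" by linarith
      then show ?thesis using False assms(3) by (simp add: of_nat_diff)
    qed
  qed
  also have "\<dots> = n * ((real q - 1) * T + t) + card U * (real q * T)"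
    using finU assms(2) by (simp add: sum.distrib sum.If_cases n_def Int_absorb1)
  finally have le: "real q * T * ((1 - 1 / q + \<epsilon>) * n) \<le>
      n * ((real q - 1) * T + t) + card U * (real q * T)" .
  have "real q * T * ((1 - 1 / q + \<epsilon>) * n) = n * ((real q - 1) * T + \<epsilon> * q * T)"
    using assms(3) by (simp add: field_simps)
  with le have "n * ((real q - 1) * T + \<epsilon> * q * T) \<le> n * ((real q - 1) * T + t) + card U * (real q * T)"
    by linarith
  then have "n * (\<epsilon> * q * T - t) \<le> card U * (real q * T)"
    by (simp add: algebra_simps)
  moreover have "n * (\<epsilon> * q * T / 2) \<le> n * (\<epsilon> * q * T - t)"
    using T(1) by (intro mult_left_mono) (auto simp: n_def algebra_simps)
  ultimately have "(n * \<epsilon> / 2) * (q * T) \<le> card U * (real q * T)" by (simp add: algebra_simps)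
  then have "n * \<epsilon> / 2 \<le> card U"
    using assms(3) T(2) mult_right_le_imp_le[of "n * \<epsilon> / 2" "real q * T" "card U"] by simp
  then have cardU: "t * 2 ^ (q * T) < card U"
  proof -
    have "real (t * 2 ^ (q * T)) < real (card U)"
      using n \<open>n * \<epsilon> / 2 \<le> card U\<close> by (simp add: n_def mult.commute)
    then show ?thesis by linarith
  qed
  define P where "P = (\<Union>i<q. S i)"
  have finP: "finite P" unfolding P_def using finS by auto
  have "card P \<le> (\<Sum>i<q. card (S i))" unfolding P_def by (rule card_UN_le) simp
  then have cardP: "card P \<le> q * T" using S(2) by simp
  \<comment> \<open>Pigeonhole: \<open>P\<close> has at most 2^(qT) subsets, and \<open>U\<close>
    has more than \<open>t\<close> times as many vertices.\<close>
  have "\<exists>Y\<in>Pow P. t \<le> card {x \<in> U. nbrs G x \<inter> P = Y}"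
  proof (rule ccontr)
    assume "\<not> ?thesis"
    then have small: "card {x \<in> U. nbrs G x \<inter> P = Y} \<le> t" if "Y \<in> Pow P" for Y
      using that nat_le_linear by blast
    have "x \<in> (\<Union>Y\<in>Pow P. {x \<in> U. nbrs G x \<inter> P = Y})" if "x \<in> U" for x
      using that by (intro UN_I[of "nbrs G x \<inter> P"]) simp_all
    then have "card U \<le> card (\<Union>Y\<in>Pow P. {x \<in> U. nbrs G x \<inter> P = Y})"
      using finU(1) finP by (intro card_mono subsetI) simp_all
    also have "\<dots> \<le> (\<Sum>Y\<in>Pow P. card {x \<in> U. nbrs G x \<inter> P = Y})"
      using finP by (intro card_UN_le) simp
    also have "\<dots> \<le> of_nat (card (Pow P)) * t"
      using small by (intro sum_bounded_above) auto
    also have "\<dots> \<le> 2 ^ (q * T) * t"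
      using cardP finP by (simp add: card_Pow power_increasing)
    finally show False using cardU by (simp add: mult.commute)
  qed
  then obtain Y where Y: "Y \<subseteq> P" "t \<le> card {x \<in> U. nbrs G x \<inter> P = Y}" by auto
  obtain R where R: "R \<subseteq> {x \<in> U. nbrs G x \<inter> P = Y}" "card R = t" "finite R"
    using Y(2) by (meson obtain_subset_with_card_n)
  \<comment> \<open>For \<open>t = 0\<close> the set \<open>R\<close> is empty, and then no member
    of \<open>R\<close> is there to show that \<open>Y\<close> meets each part in \<open>t\<close>
    vertices.\<close>
  show ?thesis
  proof (cases "t = 0")
    case True
    then show ?thesis unfolding has_multipartite_def multipartite_in_def
      by (intro exI[of _ "\<lambda>_. {}"]) auto
  next
    case False
    then obtain x0 where x0: "x0 \<in> R" using R by fastforce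
    have "\<exists>Q. Q \<subseteq> Y \<inter> S i \<and> card Q = t" if "i < q" for i
    proof -
      have "nbrs G x0 \<inter> S i \<subseteq> Y \<inter> S i" using R(1) x0 that by (auto simp: P_def)
      moreover have "t \<le> card (nbrs G x0 \<inter> S i)" using R(1) x0 that by (auto simp: U_def)
      ultimately have "t \<le> card (Y \<inter> S i)"
        using finS[OF that] by (meson card_mono finite_Int le_trans)
      then show ?thesis by (meson obtain_subset_with_card_n)
    qed
    then obtain Q where Q: "\<And>i. i < q \<Longrightarrow> Q i \<subseteq> Y \<inter> S i \<and> card (Q i) = t" by metis
    have RQ: "{x, y} \<in> edges G" if "x \<in> R" "y \<in> Q i" "i < q" for x y i
      using R(1) Q[of i] that by (auto simp: nbrs_def)
    have SS: "{x, y} \<in> edges G" if "x \<in> S i" "y \<in> S j" "i < q" "j < q" "i \<noteq> j" for x y i j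
      using S(1) that unfolding multipartite_in_def by blast
    \<comment> \<open>\<open>R\<close> may meet \<open>P\<close>, but not the chosen
      \<open>Q i\<close>, to which it is completely joined.\<close>
    have "multipartite_in G (Suc q) (Q(q := R)) A"
      unfolding multipartite_in_def
    proof (intro conjI allI impI ballI)
      fix i assume "i < Suc q"
      then show "(Q(q := R)) i \<subseteq> A" using Q SA R(1) finU(2) by (cases "i = q") (fastforce simp: less_Suc_eq)+
    next
      fix i j x y assume "i < Suc q" "j < Suc q" "i \<noteq> j" "x \<in> (Q(q := R)) i" "y \<in> (Q(q := R)) j"
      then show "{x, y} \<in> edges G"
        using RQ[of x y j] RQ[of y x i] SS[of x i y j] Q[of i] Q[of j]
        by (auto simp: less_Suc_eq insert_commute split: if_splits)
    qed
    moreover have "\<forall>i<Suc q. card ((Q(q := R)) i) = t" using Q R(2) by (auto simp: less_Suc_eq)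
    ultimately show ?thesis unfolding has_multipartite_def by blast
  qed
qed

lemma less_of_nat_large: "\<exists>n0::nat. \<forall>n\<ge>n0. (C::real) < real n"
  by (metis le_less_trans not_le of_nat_le_iff reals_Archimedean2 order_less_le_trans)

text \<open>Induction on \<open>q\<close> with the part size left general, since each extension
  starts from parts of a larger size \<open>T\<close>. Any \<open>T\<close> vertices form a K_1(T),
  which starts the induction; in the step, the degree condition for \<open>Suc q\<close> implies the
  one for \<open>q\<close>.\<close>

lemma min_degree_has_multipartite:
  fixes \<epsilon> :: real
  assumes "q \<ge> 1" "\<epsilon> > 0"
  shows "\<exists>n0. \<forall>(G :: 'a graph) A. simple_graph G \<longrightarrow> finite A \<longrightarrow> n0 \<le> card A \<longrightarrow>
           (\<forall>x\<in>A. (1 - 1 / q + \<epsilon>) * card A \<le> card (nbrs G x \<inter> A)) \<longrightarrow>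
           has_multipartite G (Suc q) t A"
  using assms(1)
proof (induction q arbitrary: t rule: dec_induct)
  case base
  obtain T0 where T0: "\<And>T. T \<ge> T0 \<Longrightarrow> 2 * t / \<epsilon> < real T" using less_of_nat_large by blast
  define T where "T = max 1 T0"
  have T: "2 * t \<le> \<epsilon> * T" "T \<ge> 1"
    using T0[of T] assms(2) by (auto simp: T_def field_simps)
  obtain n1 where n1: "\<And>n. n \<ge> n1 \<Longrightarrow> 2 * t * 2 ^ T / \<epsilon> < real n" using less_of_nat_large by blast
  show ?case
  proof (intro exI[of _ "max T n1"] allI impI)
    fix G :: "'a graph" and A
    assume G: "simple_graph G" "finite A" "max T n1 \<le> card A"
      "\<forall>x\<in>A. (1 - 1 / real 1 + \<epsilon>) * card A \<le> card (nbrs G x \<inter> A)"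
    obtain S0 where "S0 \<subseteq> A" "card S0 = T"
      using G(3) by (metis obtain_subset_with_card_n max.bounded_iff)
    then have "has_multipartite G 1 T A"
      unfolding has_multipartite_def multipartite_in_def by (intro exI[of _ "\<lambda>_. S0"]) auto
    moreover have "2 * t * 2 ^ (1 * T) < \<epsilon> * card A"
      using n1[of "card A"] G(3) assms(2) by (simp add: field_simps)
    ultimately show "has_multipartite G (Suc 1) t A"
      using T G assms(2) by (intro extend_multipartite[of G A 1 \<epsilon> t T]) auto
  qed
next
  case (step q)
  obtain T0 where T0: "\<And>T. T \<ge> T0 \<Longrightarrow> 2 * t / (\<epsilon> * Suc q) < real T" using less_of_nat_large by blast
  define T where "T = max 1 T0"
  have "2 * t / (\<epsilon> * Suc q) \<le> real T" using T0[of T] by (simp add: T_def less_imp_le)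
  then have T: "2 * t \<le> \<epsilon> * Suc q * T" "T \<ge> 1"
    using assms(2) by (auto simp: T_def pos_divide_le_eq mult.commute)
  obtain n1 where n1: "\<And>n. n \<ge> n1 \<Longrightarrow> 2 * t * 2 ^ (Suc q * T) / \<epsilon> < real n"
    using less_of_nat_large by blast
  obtain n2 where n2: "\<And>(G :: 'a graph) A. simple_graph G \<Longrightarrow> finite A \<Longrightarrow> n2 \<le> card A \<Longrightarrow>
      (\<forall>x\<in>A. (1 - 1 / q + \<epsilon>) * card A \<le> card (nbrs G x \<inter> A)) \<Longrightarrow>
      has_multipartite G (Suc q) T A"
    using step.IH by blast
  show ?case
  proof (intro exI[of _ "max n1 n2"] allI impI)
    fix G :: "'a graph" and A
    assume G: "simple_graph G" "finite A" "max n1 n2 \<le> card A"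
      "\<forall>x\<in>A. (1 - 1 / real (Suc q) + \<epsilon>) * card A \<le> card (nbrs G x \<inter> A)"
    have "1 / real (Suc q) \<le> 1 / real q" using step.hyps by (simp add: field_simps)
    then have "(1 - 1 / q + \<epsilon>) * card A \<le> (1 - 1 / real (Suc q) + \<epsilon>) * card A"
      by (intro mult_right_mono) auto
    then have "has_multipartite G (Suc q) T A"
      using G by (intro n2) (auto intro: order_trans)
    moreover have "2 * t * 2 ^ (Suc q * T) < \<epsilon> * card A"
      using n1[of "card A"] G(3) assms(2) by (simp add: pos_divide_less_eq mult.commute)
    ultimately show "has_multipartite G (Suc (Suc q)) t A"
      using T G assms(2) by (intro extend_multipartite[of G A "Suc q" \<epsilon> t T]) auto
  qed
qed

text \<open>Density turns into minimum degree on a maximiser of e(A) - c|A|^2/2. The maximiser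
  cannot be small, because its potential is of order |V|^2 while e(A) \<le> |A|^2/2.\<close>

lemma erdos_stone:
  fixes \<epsilon> :: real
  assumes "q \<ge> 1" "\<epsilon> > 0"
  shows "\<exists>n0. \<forall>(G :: 'a graph) A. simple_graph G \<longrightarrow> finite A \<longrightarrow> n0 \<le> card A \<longrightarrow>
           (1 - 1 / q + \<epsilon>) * (card A)\<^sup>2 / 2 \<le> card (edges_in G A) \<longrightarrow>
           has_multipartite G (Suc q) t A"
proof -
  obtain n1 where n1: "\<And>(G :: 'a graph) A. simple_graph G \<Longrightarrow> finite A \<Longrightarrow> n1 \<le> card A \<Longrightarrow>
      (\<forall>x\<in>A. (1 - 1 / q + \<epsilon> / 4) * card A \<le> card (nbrs G x \<inter> A)) \<Longrightarrow>
      has_multipartite G (Suc q) t A"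
    using min_degree_has_multipartite[OF assms(1), of "\<epsilon> / 4" t] assms(2) by auto
  \<comment> \<open>Half of the surplus \<epsilon> stays in the potential of \<open>V\<close> and
    makes \<open>A\<close> large. Of the other half, \<epsilon>/4 absorbs the \<open>c / 2\<close>
    in the degree bound and \<epsilon>/4 remains as surplus in the minimum degree.\<close>
  define c where "c = 1 - 1 / q + \<epsilon> / 2"
  define m where "m = max (real n1) (2 * c / \<epsilon>)"
  obtain n0 where n0: "\<And>n. n \<ge> n0 \<Longrightarrow> 2 * m / \<epsilon> + 2 * m + 1 < real n" using less_of_nat_large by blast
  have c0: "c > 0" using assms by (simp add: c_def add_nonneg_pos)
  show ?thesis
  proof (intro exI[of _ n0] allI impI)
    fix G :: "'a graph" and V
    assume G: "simple_graph G" "finite V" "n0 \<le> card V"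
      and e: "(1 - 1 / q + \<epsilon>) * (card V)\<^sup>2 / 2 \<le> card (edges_in G V)"
    obtain A where A: "A \<subseteq> V" "\<And>v. v \<in> A \<Longrightarrow> c * (card A - 1/2) \<le> card (nbrs G v \<inter> A)"
      "card (edges_in G V) - c * (card V)\<^sup>2 / 2 \<le> card (edges_in G A) - c * (card A)\<^sup>2 / 2"
      using exists_subset_min_degree[OF G(1,2), of c] by blast
    have finA: "finite A" using A(1) G(2) finite_subset by blast
    have "real (2 * card (edges_in G A)) \<le> real ((card A)\<^sup>2)"
      using card_edges_in_le_square[OF G(1) finA] by linarith
    moreover have "\<epsilon> * (card V)\<^sup>2 / 4 \<le> card (edges_in G V) - c * (card V)\<^sup>2 / 2"
    proof -
      have "c * (card V)\<^sup>2 / 2 = (1 - 1 / q + \<epsilon>) * (card V)\<^sup>2 / 2 - \<epsilon> * (card V)\<^sup>2 / 4"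
        by (simp add: c_def algebra_simps add_divide_distrib diff_divide_distrib)
      then show ?thesis using e by linarith
    qed
    moreover have "0 \<le> c * (card A)\<^sup>2 / 2" using c0 by simp
    ultimately have le: "\<epsilon> * (real (card V))\<^sup>2 \<le> 2 * (real (card A))\<^sup>2"
      using A(3) by simp
    have m: "m < card A"
    proof (rule ccontr)
      assume "\<not> m < card A"
      then have "(real (card A))\<^sup>2 \<le> m\<^sup>2" by (intro power_mono) auto
      then have le2: "\<epsilon> * (real (card V))\<^sup>2 \<le> 2 * m\<^sup>2" using le by linarith
      have m0: "0 \<le> m" by (simp add: m_def)
      have V: "2 * m / \<epsilon> + 2 * m + 1 < card V" using n0 G(3) by blast
      have "2 * m / \<epsilon> \<ge> 0" using m0 assms by simp
      then have "2 * m / \<epsilon> < card V" "m < card V" using V m0 by linarith+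
      then have "2 * m / \<epsilon> * m < real (card V) * real (card V)"
        using m0 \<open>2 * m / \<epsilon> \<ge> 0\<close>
        by (intro mult_strict_mono) auto
      then show False using le2 assms(2) by (simp add: field_simps power2_eq_square)
    qed
    have "(1 - 1 / q + \<epsilon> / 4) * card A \<le> card (nbrs G x \<inter> A)" if "x \<in> A" for x
    proof -
      have "2 * c / \<epsilon> \<le> card A" using m by (simp add: m_def)
      then have "c / 2 \<le> \<epsilon> / 4 * card A" using assms(2) by (simp add: field_simps)
      then show ?thesis using A(2)[OF that] by (simp add: c_def algebra_simps)
    qed
    then have "has_multipartite G (Suc q) t A"
      using G(1) finA m by (intro n1) (auto simp: m_def)
    then show "has_multipartite G (Suc q) t V" using A(1) has_multipartite_mono by blast
  qed
qed

text \<open>The set is a maximiser of \<open>e(A) - c|A|\<^sup>2/2\<close> with \<open>c\<close> slightly below \<open>1 - 1/q\<close>: the Erdos--Stone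
  bound on this potential forces the maximiser to be almost everything.\<close>

lemma almost_regular_subset:
  fixes \<epsilon> :: real
  assumes "q \<ge> 1" "\<epsilon> > 0" "\<epsilon> \<le> 1"
  shows "\<exists>\<delta>>0. \<exists>n0. \<forall>(G :: 'a graph) V. simple_graph G \<longrightarrow> finite V \<longrightarrow> n0 \<le> card V \<longrightarrow>
           (1 - 1 / q - \<delta>) * (card V)\<^sup>2 / 2 \<le> card (edges_in G V) \<longrightarrow>
           \<not> has_multipartite G (Suc q) t V \<longrightarrow>
           (\<exists>A\<subseteq>V. (1 - \<epsilon>) * card V \<le> card A \<and>
              (\<forall>x\<in>A. (1 - 1 / q - \<epsilon>) * card A \<le> card (nbrs G x \<inter> A)))"
proof -
  \<comment> \<open>With this value (\<epsilon>/2 + \<delta>)/(\<epsilon>/2 - \<delta>) equals (1 +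
    \<epsilon>/4)/(1 - \<epsilon>/4), close enough to 1 to give |A| \<ge> (1 -
    \<epsilon>)|V|.\<close>
  define \<delta> where "\<delta> = \<epsilon>\<^sup>2 / 8"
  have d: "\<delta> > 0" "\<delta> \<le> \<epsilon> / 8" using assms by (auto simp: \<delta>_def power2_eq_square mult_le_one)
  obtain n1 where n1: "\<And>(G :: 'a graph) A. simple_graph G \<Longrightarrow> finite A \<Longrightarrow> n1 \<le> card A \<Longrightarrow>
      (1 - 1 / q + \<delta>) * (card A)\<^sup>2 / 2 \<le> card (edges_in G A) \<Longrightarrow> has_multipartite G (Suc q) t A"
    using erdos_stone[OF assms(1) d(1), of t] by blast
  define c where "c = 1 - 1 / q - \<epsilon> / 2"
  have "1 / real q \<le> 1" "0 \<le> 1 / real q" using assms(1) by auto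
  then have c1: "c \<le> 1" "-1 \<le> c" using assms(2,3) unfolding c_def by linarith+
  define m where "m = max (real n1) (1 / \<epsilon>)"
  have m0: "0 \<le> m" by (simp add: m_def)
  obtain n0 where n0: "\<And>n. n \<ge> n0 \<Longrightarrow> 8 * m / \<epsilon> + 8 * m + 1 < real n" using less_of_nat_large by blast
  show ?thesis
  proof (intro exI[of _ \<delta>] exI[of _ n0] allI impI conjI d(1))
    fix G :: "'a graph" and V
    assume G: "simple_graph G" "finite V" "n0 \<le> card V"
      and e: "(1 - 1 / q - \<delta>) * (card V)\<^sup>2 / 2 \<le> card (edges_in G V)"
      and no: "\<not> has_multipartite G (Suc q) t V"
    obtain A where A: "A \<subseteq> V" "\<And>v. v \<in> A \<Longrightarrow> c * (card A - 1/2) \<le> card (nbrs G v \<inter> A)"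
      "card (edges_in G V) - c * (card V)\<^sup>2 / 2 \<le> card (edges_in G A) - c * (card A)\<^sup>2 / 2"
      using exists_subset_min_degree[OF G(1,2), of c] by blast
    define a where "a = real (card A)"
    define n where "n = real (card V)"
    have an0: "0 \<le> a" "0 \<le> n" by (auto simp: a_def n_def)
    have finA: "finite A" using A(1) G(2) finite_subset by blast
    have low: "(\<epsilon> / 2 - \<delta>) * n\<^sup>2 / 2 \<le> card (edges_in G A) - c * a\<^sup>2 / 2"
    proof -
      have "(\<epsilon> / 2 - \<delta>) * n\<^sup>2 / 2 = (1 - 1 / q - \<delta>) * (card V)\<^sup>2 / 2 - c * (card V)\<^sup>2 / 2"
        by (simp add: c_def n_def algebra_simps add_divide_distrib diff_divide_distrib)
      then show ?thesis using e A(3) by (simp add: a_def)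
    qed
    \<comment> \<open>The trivial bound on e(A) comes first: \<open>A\<close> must be known to
      exceed \<open>n1\<close> before the Erdos-Stone bound can be applied to it.\<close>
    have "real (2 * card (edges_in G A)) \<le> real ((card A)\<^sup>2)"
      using card_edges_in_le_square[OF G(1) finA] by linarith
    then have "2 * card (edges_in G A) \<le> a\<^sup>2" by (simp add: a_def)
    moreover have "-1 * a\<^sup>2 \<le> c * a\<^sup>2" using c1 by (intro mult_right_mono) auto
    ultimately have "(\<epsilon> / 2 - \<delta>) * n\<^sup>2 \<le> 2 * a\<^sup>2" using low by linarith
    moreover have "\<epsilon> / 4 * n\<^sup>2 \<le> (\<epsilon> / 2 - \<delta>) * n\<^sup>2" using d assms by (intro mult_right_mono) auto
    ultimately have le: "\<epsilon> * n\<^sup>2 \<le> 8 * a\<^sup>2" by linarith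
    have m: "m < a"
    proof (rule ccontr)
      assume "\<not> m < a"
      then have "a\<^sup>2 \<le> m\<^sup>2" using an0 by (intro power_mono) auto
      then have le2: "\<epsilon> * n\<^sup>2 \<le> 8 * m\<^sup>2" using le by linarith
      have V: "8 * m / \<epsilon> + 8 * m + 1 < n" using n0 G(3) by (simp add: n_def)
      have "8 * m / \<epsilon> \<ge> 0" using m0 assms by simp
      then have "8 * m / \<epsilon> < n" "m < n" using V m0 by linarith+
      then have "8 * m / \<epsilon> * m < n * n"
        using m0 \<open>8 * m / \<epsilon> \<ge> 0\<close> by (intro mult_strict_mono) auto
      then show False using le2 assms(2) by (simp add: field_simps power2_eq_square)
    qed
    have "\<not> has_multipartite G (Suc q) t A" using no A(1) has_multipartite_mono by blast
    then have up: "\<not> (1 - 1 / q + \<delta>) * a\<^sup>2 / 2 \<le> card (edges_in G A)"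
      using n1[OF G(1) finA] m by (auto simp: m_def a_def)
    have "(1 - 1 / q + \<delta>) * a\<^sup>2 / 2 = (\<epsilon> / 2 + \<delta>) * a\<^sup>2 / 2 + c * a\<^sup>2 / 2"
      by (simp add: c_def algebra_simps add_divide_distrib diff_divide_distrib)
    then have "(\<epsilon> / 2 - \<delta>) * n\<^sup>2 \<le> (\<epsilon> / 2 + \<delta>) * a\<^sup>2"
      using low up by linarith
    then have "(\<epsilon> / 2) * ((1 - \<epsilon> / 4) * n\<^sup>2) \<le> (\<epsilon> / 2) * ((1 + \<epsilon> / 4) * a\<^sup>2)"
      by (simp add: \<delta>_def power2_eq_square algebra_simps)
    then have "(1 - \<epsilon> / 4) * n\<^sup>2 \<le> (1 + \<epsilon> / 4) * a\<^sup>2"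
      using assms(2) by (subst (asm) mult_le_cancel_left_pos) auto
    moreover have "(1 + \<epsilon> / 4) * ((1 - \<epsilon>)\<^sup>2 * n\<^sup>2) \<le> (1 - \<epsilon> / 4) * n\<^sup>2"
    proof -
      have "(1 - \<epsilon>)\<^sup>2 \<le> 1 - \<epsilon>" using assms by (simp add: power2_eq_square mult_left_le)
      then have "(1 + \<epsilon> / 4) * (1 - \<epsilon>)\<^sup>2 \<le> (1 + \<epsilon> / 4) * (1 - \<epsilon>)"
        using assms by (intro mult_left_mono) auto
      also have "\<dots> \<le> 1 - \<epsilon> / 4" using assms by (simp add: algebra_simps)
      finally have "(1 + \<epsilon> / 4) * (1 - \<epsilon>)\<^sup>2 * n\<^sup>2 \<le> (1 - \<epsilon> / 4) * n\<^sup>2"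
        by (intro mult_right_mono) auto
      then show ?thesis by (simp add: mult.assoc)
    qed
    ultimately have "(1 + \<epsilon> / 4) * ((1 - \<epsilon>)\<^sup>2 * n\<^sup>2) \<le> (1 + \<epsilon> / 4) * a\<^sup>2" by linarith
    then have "((1 - \<epsilon>) * n)\<^sup>2 \<le> a\<^sup>2"
      using assms(2) by (subst (asm) mult_le_cancel_left_pos) (auto simp: power_mult_distrib)
    then have "(1 - \<epsilon>) * n \<le> a" using an0(1) power2_le_imp_le by blast
    moreover have "(1 - 1 / q - \<epsilon>) * card A \<le> card (nbrs G x \<inter> A)" if "x \<in> A" for x
    proof -
      have "1 / \<epsilon> < a" using m by (simp add: m_def)
      then have "1 \<le> \<epsilon> * a" using assms(2) by (simp add: field_simps)
      moreover have "c * (a - 1/2) = (1 - 1 / q - \<epsilon>) * a + \<epsilon> * a / 2 - c / 2"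
        by (simp add: c_def algebra_simps add_divide_distrib diff_divide_distrib)
      ultimately show ?thesis using A(2)[OF that] c1(1) by (simp add: a_def)
    qed
    ultimately show "\<exists>A\<subseteq>V. (1 - \<epsilon>) * card V \<le> card A \<and>
              (\<forall>x\<in>A. (1 - 1 / q - \<epsilon>) * card A \<le> card (nbrs G x \<inter> A))"
      using A(1) by (auto simp: a_def n_def)
  qed
qed

text \<open>In an almost regular set \<open>A\<close> each vertex misses about |A|/r others. Inside
  a neighbourhood of relative size 1 - 1/r this leaves relative degree 1 - 1/(r - 1), exactly the
  threshold for K_r(t); the surplus \<epsilon> in the degree of \<open>v\<close> lifts it above, and
  the vertices outside \<open>A\<close> or in \<open>Z\<close> use up only part of that
  surplus.\<close>

lemma high_degree_nbrs_has_multipartite: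
  fixes \<epsilon> :: real
  assumes r: "r \<ge> 2" and eps: "\<epsilon> > 0" "\<epsilon> \<le> 1"
  shows "\<exists>\<delta>>0. \<exists>n0. \<forall>(G :: 'a graph) V v Z. simple_graph G \<longrightarrow> finite V \<longrightarrow> n0 \<le> card V \<longrightarrow>
           (1 - 1 / r - \<delta>) * (card V)\<^sup>2 / 2 \<le> card (edges_in G V) \<longrightarrow>
           \<not> has_multipartite G (Suc r) T V \<longrightarrow>
           (1 - 1 / r + \<epsilon>) * card V \<le> card (nbrs G v \<inter> V) \<longrightarrow> finite Z \<longrightarrow> card Z \<le> K \<longrightarrow>
           has_multipartite G r t (nbrs G v \<inter> V - Z)"
proof -
  \<comment> \<open>Chosen for 1/r + \<epsilon>1 \<le> (1/(r - 1) - \<eta>)(1 - 1/r + \<epsilon>/2):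
    the right side exceeds 1/r by at least \<epsilon>/(2(r - 1)) - 2\<eta> = \<epsilon>/(4(r -
    1)).\<close>
  define \<epsilon>1 where "\<epsilon>1 = \<epsilon> / (4 * r)"
  define \<eta> where "\<eta> = \<epsilon> / (8 * (real r - 1))"
  have r1: "real r - 1 \<ge> 1" using r by linarith
  have e1: "\<epsilon>1 > 0" "\<epsilon>1 \<le> \<epsilon> / 4" "\<epsilon>1 \<le> 1" and eta: "\<eta> > 0"
  proof -
    show "\<epsilon>1 > 0" using eps r by (simp add: \<epsilon>1_def)
    show "\<epsilon>1 \<le> \<epsilon> / 4" using eps r unfolding \<epsilon>1_def by (intro divide_left_mono) auto
    then show "\<epsilon>1 \<le> 1" using eps by linarith
    show "\<eta> > 0" using eps r1 by (simp add: \<eta>_def)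
  qed
  obtain \<delta> n1 where d: "\<delta> > 0" and n1: "\<And>(G :: 'a graph) V. simple_graph G \<Longrightarrow> finite V \<Longrightarrow> n1 \<le> card V \<Longrightarrow>
           (1 - 1 / r - \<delta>) * (card V)\<^sup>2 / 2 \<le> card (edges_in G V) \<Longrightarrow>
           \<not> has_multipartite G (Suc r) T V \<Longrightarrow>
           (\<exists>A\<subseteq>V. (1 - \<epsilon>1) * card V \<le> card A \<and>
              (\<forall>x\<in>A. (1 - 1 / r - \<epsilon>1) * card A \<le> card (nbrs G x \<inter> A)))"
  proof -
    have "r \<ge> 1" using r by simp
    from almost_regular_subset[OF this e1(1,3), of T, where 'a = 'a] that show thesis by blast
  qed
  have "\<exists>n0. \<forall>(G :: 'a graph) A. simple_graph G \<longrightarrow> finite A \<longrightarrow> n0 \<le> card A \<longrightarrow>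
      (\<forall>x\<in>A. (1 - 1 / (r - 1 :: nat) + \<eta>) * card A \<le> card (nbrs G x \<inter> A)) \<longrightarrow>
      has_multipartite G (Suc (r - 1)) t A"
    using r eta by (intro min_degree_has_multipartite) auto
  then obtain n2 where n2: "\<And>(G :: 'a graph) A. simple_graph G \<Longrightarrow> finite A \<Longrightarrow> n2 \<le> card A \<Longrightarrow>
      (\<forall>x\<in>A. (1 - 1 / (real r - 1) + \<eta>) * card A \<le> card (nbrs G x \<inter> A)) \<Longrightarrow>
      has_multipartite G r t A"
    using r by (auto simp: of_nat_diff)
  obtain n3 where n3: "\<And>n. n \<ge> n3 \<Longrightarrow> 4 * K / \<epsilon> + 2 * real n2 < real n" using less_of_nat_large by blast
  show ?thesis
  proof (intro exI[of _ \<delta>] exI[of _ "max n1 n3"] allI impI conjI d)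
    fix G :: "'a graph" and V Z :: "'a set" and v
    assume G: "simple_graph G" "finite V" "max n1 n3 \<le> card V"
      and e: "(1 - 1 / r - \<delta>) * (card V)\<^sup>2 / 2 \<le> card (edges_in G V)"
      and no: "\<not> has_multipartite G (Suc r) T V"
      and deg: "(1 - 1 / r + \<epsilon>) * card V \<le> card (nbrs G v \<inter> V)"
      and Z: "finite Z" "card Z \<le> K"
    obtain A where A: "A \<subseteq> V" "(1 - \<epsilon>1) * card V \<le> card A"
        "\<And>x. x \<in> A \<Longrightarrow> (1 - 1 / r - \<epsilon>1) * card A \<le> card (nbrs G x \<inter> A)"
      using n1[OF G(1,2) _ e no] G(3) by auto
    have finA: "finite A" using A(1) G(2) finite_subset by blast
    define B where "B = nbrs G v \<inter> A - Z"
    have finB: "finite B" "B \<subseteq> A" using finA by (auto simp: B_def)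
    define n where "n = real (card V)"
    have n: "4 * K / \<epsilon> + 2 * real n2 < n" using n3 G(3) by (auto simp: n_def)
    have nK: "real K \<le> \<epsilon> / 4 * n"
    proof -
      have "4 * K / \<epsilon> \<le> n" using n by linarith
      then show ?thesis using eps by (simp add: field_simps)
    qed
    have "nbrs G v \<inter> V \<subseteq> B \<union> Z \<union> (V - A)" by (auto simp: B_def)
    then have "card (nbrs G v \<inter> V) \<le> card (B \<union> Z \<union> (V - A))"
      using finB Z G(2) by (intro card_mono) auto
    also have "\<dots> \<le> card B + card Z + card (V - A)"
      by (meson add_right_mono card_Un_le le_trans)
    also have "card (V - A) = card V - card A" using A(1) finA by (simp add: card_Diff_subset)
    finally have "real (card (nbrs G v \<inter> V)) \<le> card B + card Z + (card V - card A)" by linarith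
    moreover have "real (card V - card A) = n - card A"
      using A(1) G(2) by (simp add: n_def card_mono of_nat_diff)
    ultimately have "(1 - 1 / r + \<epsilon>) * n \<le> card B + K + \<epsilon>1 * n"
      using deg Z(2) A(2) by (simp add: n_def algebra_simps)
    moreover have "\<epsilon>1 * n \<le> \<epsilon> / 4 * n" using e1(2) by (intro mult_right_mono) (auto simp: n_def)
    ultimately have B: "(1 - 1 / r + \<epsilon> / 2) * n \<le> card B" using nK by (simp add: algebra_simps)
    have half: "1 / 2 \<le> 1 - 1 / real r" using r by (simp add: field_simps)
    have n0: "0 \<le> n" by (simp add: n_def)
    have "(1 / 2) * n \<le> (1 - 1 / r + \<epsilon> / 2) * n"
      using half eps n0 by (intro mult_right_mono) auto
    moreover have "0 \<le> 4 * K / \<epsilon>" using eps by simp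
    ultimately have "n2 \<le> card B" using B n by linarith
    moreover have "(1 - 1 / (real r - 1) + \<eta>) * card B \<le> card (nbrs G x \<inter> B)" if x: "x \<in> B" for x
    proof -
      have "card (nbrs G x \<inter> A) + card (A - nbrs G x) = card A"
        using finA by (metis Diff_Int2 Int_Diff_Un Int_Diff_disjoint card_Un_disjoint finite_Diff finite_Int inf_commute)
      moreover have "card B \<le> card ((nbrs G x \<inter> B) \<union> (A - nbrs G x))"
        using finB finA by (intro card_mono) auto
      moreover have "card ((nbrs G x \<inter> B) \<union> (A - nbrs G x)) \<le> card (nbrs G x \<inter> B) + card (A - nbrs G x)"
        by (rule card_Un_le)
      moreover have "(1 - 1 / r - \<epsilon>1) * card A \<le> card (nbrs G x \<inter> A)" using x finB A(3) by blast
      ultimately have "card B - (1 / r + \<epsilon>1) * card A \<le> card (nbrs G x \<inter> B)"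
        by (simp add: algebra_simps)
      moreover have "(1 / r + \<epsilon>1) * card A \<le> (1 / r + \<epsilon>1) * n"
        using A(1) G(2) e1 by (intro mult_left_mono) (auto simp: n_def card_mono)
      moreover have "(1 / r + \<epsilon>1) * n \<le> (1 / (real r - 1) - \<eta>) * card B"
      proof -
        have "1 / r + \<epsilon>1 \<le> (1 / (real r - 1) - \<eta>) * (1 - 1 / r + \<epsilon> / 2)"
        proof -
          have dist: "(x - y) * (z + w) = x * z + x * w - y * (z + w)" for x y z w :: real
            by (simp add: algebra_simps)
          have "(1 / (real r - 1)) * (1 - 1 / r) = 1 / r" using r1 r by (simp add: field_simps)
          then have "(1 / (real r - 1) - \<eta>) * (1 - 1 / r + \<epsilon> / 2) =
              1 / r + \<epsilon> / (2 * (real r - 1)) - \<eta> * (1 - 1 / r + \<epsilon> / 2)"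
            unfolding dist by simp
          moreover have "\<eta> * (1 - 1 / r + \<epsilon> / 2) \<le> \<eta> * 2"
          proof (rule mult_left_mono)
            have "0 \<le> 1 / real r" by simp
            then show "1 - 1 / r + \<epsilon> / 2 \<le> 2" using eps by linarith
          qed (use eta in simp)
          moreover have "\<epsilon> / (8 * p) * 2 = \<epsilon> / (2 * p) / 2" for p :: real by simp
          then have "\<eta> * 2 = \<epsilon> / (2 * (real r - 1)) / 2" unfolding \<eta>_def .
          moreover have "\<epsilon>1 \<le> \<epsilon> / (2 * (real r - 1)) / 2"
            using eps r1 r by (simp add: \<epsilon>1_def field_simps)
          \<comment> \<open>The facts combine linearly in the fractions, so the combination is
            proved with arbitrary reals in their place.\<close>
          moreover have "x = a + b - y \<Longrightarrow> y \<le> z \<Longrightarrow> z = b / 2 \<Longrightarrow> e \<le> b / 2 \<Longrightarrow> a + e \<le> x"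
            for x a b y z e :: real by linarith
          ultimately show ?thesis by blast
        qed
        then have "(1 / r + \<epsilon>1) * n \<le> (1 / (real r - 1) - \<eta>) * (1 - 1 / r + \<epsilon> / 2) * n"
          using n0 by (intro mult_right_mono)
        also have "\<dots> = (1 / (real r - 1) - \<eta>) * ((1 - 1 / r + \<epsilon> / 2) * n)" by simp
        also have "\<dots> \<le> (1 / (real r - 1) - \<eta>) * card B"
        proof (intro mult_left_mono B)
          show "0 \<le> 1 / (real r - 1) - \<eta>"
          proof -
            have "\<epsilon> / 8 / (real r - 1) \<le> 1 / (real r - 1)"
              using eps r1 by (intro divide_right_mono) auto
            then have "\<eta> \<le> 1 / (real r - 1)" unfolding \<eta>_def divide_divide_eq_left .
            then show ?thesis by linarith
          qed
        qed
        finally show ?thesis .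
      qed
      ultimately show ?thesis by (simp add: algebra_simps)
    qed
    ultimately have "has_multipartite G r t B" using G(1) finB by (intro n2) auto
    moreover have "B \<subseteq> nbrs G v \<inter> V - Z" using A(1) by (auto simp: B_def)
    ultimately show "has_multipartite G r t (nbrs G v \<inter> V - Z)" using has_multipartite_mono by blast
  qed
qed

section \<open>Embeddings and extremal numbers\<close>

definition embedding :: "('f \<Rightarrow> 'a) \<Rightarrow> 'f graph \<Rightarrow> 'a graph \<Rightarrow> bool" where
  "embedding f F G \<longleftrightarrow> inj_on f (verts F) \<and> f ` verts F \<subseteq> verts G \<and> (\<forall>e\<in>edges F. f ` e \<in> edges G)"

text \<open>Injective maps replace isomorphic subgraphs from here on. Inverting the isomorphism
  yields the map, and the image graph of a map yields the subgraph.\<close>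

lemma graph_free_iff:
  assumes F: "simple_graph F"
  shows "graph_free F G \<longleftrightarrow> \<not> (\<exists>f. embedding f F G)"
proof -
  have "\<exists>f. embedding f F G" if S: "subgraph S G" "graph_iso S F" for S
  proof -
    obtain g where g: "bij_betw g (verts S) (verts F)" "(\<lambda>e. g ` e) ` edges S = edges F"
      using S(2) by (auto simp: graph_iso_def)
    define f where "f = the_inv_into (verts S) g"
    have f: "bij_betw f (verts F) (verts S)" using g(1) by (simp add: f_def bij_betw_the_inv_into)
    have "f ` e \<in> edges G" if e: "e \<in> edges F" for e
    proof -
      obtain d where d: "d \<in> edges S" "e = g ` d" using e unfolding g(2)[symmetric] by (elim imageE)
      have "d \<subseteq> verts S" using S(1) d(1) by (auto simp: subgraph_def simple_graph_def)
      then have "f ` e = d" unfolding d(2) image_image f_def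
        using g(1) by (force simp: bij_betw_def the_inv_into_f_f)
      then show ?thesis using d(1) S(1) by (auto simp: subgraph_def)
    qed
    moreover have "inj_on f (verts F)" "f ` verts F \<subseteq> verts G"
      using f S(1) by (auto simp: bij_betw_def subgraph_def)
    ultimately show ?thesis by (auto simp: embedding_def)
  qed
  moreover have "\<exists>S. subgraph S G \<and> graph_iso S F" if f: "embedding f F G" for f
  proof -
    define S where "S = \<lparr>verts = f ` verts F, edges = (\<lambda>e. f ` e) ` edges F\<rparr>"
    have inj: "inj_on f (verts F)" using f by (simp add: embedding_def)
    have sub: "e \<subseteq> verts F" "card e = 2" if "e \<in> edges F" for e
      using F that by (auto simp: simple_graph_def)
    have "simple_graph S"
      using F sub inj by (auto simp: simple_graph_def S_def card_image inj_on_subset)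
    then have "subgraph S G" using f by (auto simp: subgraph_def S_def embedding_def)
    moreover have "graph_iso S F" unfolding graph_iso_def
    proof (intro exI[of _ "the_inv_into (verts F) f"] conjI)
      show "bij_betw (the_inv_into (verts F) f) (verts S) (verts F)"
        using inj by (simp add: S_def bij_betw_the_inv_into bij_betw_def inj_on_the_inv_into)
      have "the_inv_into (verts F) f ` f ` e = e" if "e \<in> edges F" for e
        using sub(1)[OF that] inj unfolding image_image
        by (force simp: the_inv_into_f_f)
      then have "(\<lambda>e. the_inv_into (verts F) f ` f ` e) ` edges F = (\<lambda>e. e) ` edges F"
        by (intro image_cong) auto
      then show "(\<lambda>e. the_inv_into (verts F) f ` e) ` edges S = edges F"
        by (simp add: S_def image_image)
    qed
    ultimately show ?thesis by blast
  qed
  ultimately show ?thesis unfolding graph_free_def by blast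
qed

lemma embedding_trans: "embedding f F G \<Longrightarrow> embedding g G H \<Longrightarrow> embedding (g \<circ> f) F H"
  unfolding embedding_def by (auto simp del: o_apply simp: image_comp[symmetric] intro!: comp_inj_on intro: inj_on_subset)

definition induced :: "'a graph \<Rightarrow> 'a set \<Rightarrow> 'a graph" where
  "induced G A = \<lparr>verts = A, edges = edges_in G A\<rparr>"

lemma simple_induced: "simple_graph G \<Longrightarrow> finite A \<Longrightarrow> simple_graph (induced G A)"
  by (auto simp: simple_graph_def induced_def edges_in_def)

lemma embedding_induced_iff:
  assumes "simple_graph F" "A \<subseteq> verts G"
  shows "embedding f F (induced G A) \<longleftrightarrow> embedding f F G \<and> f ` verts F \<subseteq> A"
  using assms by (auto simp: embedding_def induced_def edges_in_def simple_graph_def) blast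

lemma graph_free_induced_iff:
  assumes "simple_graph F" "A \<subseteq> verts G"
  shows "graph_free F (induced G A) \<longleftrightarrow> \<not> (\<exists>f. embedding f F G \<and> f ` verts F \<subseteq> A)"
  by (simp add: graph_free_iff[OF assms(1)] embedding_induced_iff[OF assms])

text \<open>Colour classes go injectively into parts. Part sizes are compared class by class rather
  than with the order of \<open>F\<close>, so that a one-vertex part can receive a one-vertex
  class.\<close>

lemma embedding_colour_classes:
  assumes F: "simple_graph F" and c: "proper_colouring F q c"
    and S: "multipartite_in G q S (verts G)" and fin: "\<And>i. i < q \<Longrightarrow> finite (S i)"
    and G: "simple_graph G"
    and card: "\<And>i. i < q \<Longrightarrow> card {x \<in> verts F. c x = i} \<le> card (S i)"
  shows "\<exists>f. embedding f F G \<and> (\<forall>x\<in>verts F. f x \<in> S (c x))"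
proof -
  have "\<exists>g. g ` {x \<in> verts F. c x = i} \<subseteq> S i \<and> inj_on g {x \<in> verts F. c x = i}" if "i < q" for i
    using F fin[OF that] card[OF that] by (intro card_le_inj) (auto simp: simple_graph_def)
  then obtain g where g: "\<And>i. i < q \<Longrightarrow> g i ` {x \<in> verts F. c x = i} \<subseteq> S i \<and>
      inj_on (g i) {x \<in> verts F. c x = i}" by metis
  define f where "f x = g (c x) x" for x
  have cq: "c x < q" if "x \<in> verts F" for x using c that by (auto simp: proper_colouring_def)
  have fS: "f x \<in> S (c x)" if "x \<in> verts F" for x
    using g[OF cq[OF that]] that by (auto simp: f_def)
  have adj: "{f x, f y} \<in> edges G" if "x \<in> verts F" "y \<in> verts F" "c x \<noteq> c y" for x y
    using S fS cq that unfolding multipartite_in_def by blast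
  have "inj_on f (verts F)"
  proof (rule inj_onI)
    fix x y assume xy: "x \<in> verts F" "y \<in> verts F" "f x = f y"
    have "c x = c y"
    proof (rule ccontr)
      assume "c x \<noteq> c y"
      then have "{f x, f x} \<in> edges G" using adj[of x y] xy by simp
      then show False using G by (auto simp: simple_graph_def)
    qed
    then show "x = y" using xy g[OF cq[OF xy(1)]] by (auto simp: f_def inj_on_def)
  qed
  moreover have "f ` verts F \<subseteq> verts G"
    using fS cq S by (fastforce simp: multipartite_in_def)
  moreover have "f ` e \<in> edges G" if e: "e \<in> edges F" for e
  proof -
    have "card e = 2" "e \<subseteq> verts F" using e F by (auto simp: simple_graph_def)
    then obtain x y where xy: "e = {x, y}" "x \<in> verts F" "y \<in> verts F" by (auto simp: card_2_iff)
    then have "c x \<noteq> c y" using c e by (auto simp: proper_colouring_def)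
    then show ?thesis using adj xy by simp
  qed
  ultimately show ?thesis using fS by (auto simp: embedding_def)
qed

lemma chromatic_number_colouring:
  assumes "simple_graph F"
  shows "\<exists>c. proper_colouring F (chromatic_number F) c"
proof -
  have "finite (verts F)" using assms by (simp add: simple_graph_def)
  then obtain c :: "'a \<Rightarrow> nat" where c: "inj_on c (verts F)" "c ` verts F = {..<card (verts F)}"
    by (metis bij_betw_def ex_bij_betw_finite_nat atLeast0LessThan)
  have "proper_colouring F (card (verts F)) c"
    unfolding proper_colouring_def
  proof (intro conjI allI impI)
    fix u v assume "{u, v} \<in> edges F"
    then have "u \<noteq> v" "u \<in> verts F" "v \<in> verts F" using assms by (auto simp: simple_graph_def)
    then show "c u \<noteq> c v" using c(1) by (auto simp: inj_on_def)
  qed (use c in auto)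
  then have "\<exists>k c. proper_colouring F k c" by blast
  then show ?thesis unfolding chromatic_number_def by (rule LeastI_ex)
qed

text \<open>An \<open>r\<close>-colouring of \<open>F\<close> without the critical vertex, which
  then gets the fresh colour \<open>r\<close> for itself.\<close>

lemma critical_colouring:
  assumes F: "simple_graph F" "vertex_critical F" "chromatic_number F = r + 1"
  obtains u c where "u \<in> verts F" "proper_colouring F (Suc r) c"
    "{x \<in> verts F. c x = r} = {u}"
proof -
  obtain u where u: "u \<in> verts F" "chromatic_number (delete_vertex F u) = r"
    using F by (auto simp: vertex_critical_def)
  have "simple_graph (delete_vertex F u)" using F(1) by (auto simp: simple_graph_def delete_vertex_def)
  then obtain c where c: "proper_colouring (delete_vertex F u) r c"
    using chromatic_number_colouring u(2) by blast
  have cr: "c x < r" if "x \<in> verts F" "x \<noteq> u" for x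
    using c that by (auto simp: proper_colouring_def delete_vertex_def)
  have "proper_colouring F (Suc r) (c(u := r))"
    unfolding proper_colouring_def
  proof (intro conjI allI impI)
    show "(c(u := r)) ` verts F \<subseteq> {..<Suc r}" using cr less_Suc_eq by auto
    fix x y assume xy: "{x, y} \<in> edges F"
    then have ne: "x \<noteq> y" "x \<in> verts F" "y \<in> verts F" using F(1) by (auto simp: simple_graph_def)
    show "(c(u := r)) x \<noteq> (c(u := r)) y"
    proof (cases "x = u \<or> y = u")
      case True
      then show ?thesis using ne cr by fastforce
    next
      case False
      then have "{x, y} \<in> edges (delete_vertex F u)" using xy by (auto simp: delete_vertex_def)
      then show ?thesis using c False by (auto simp: proper_colouring_def)
    qed
  qed
  moreover have "{x \<in> verts F. (c(u := r)) x = r} = {u}"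
    using u(1) cr by (auto simp: less_le)
  ultimately show thesis using that u(1) by blast
qed

text \<open>\<open>v\<close> together with the K_r(t) in its neighbourhood is complete (r +
  1)-partite with last part \<open>{v}\<close>, matching the one-vertex colour class of
  \<open>F\<close>. All other vertices of the copy avoid \<open>Z\<close>.\<close>

lemma critical_embedding:
  assumes F: "simple_graph F" "vertex_critical F" "chromatic_number F = r + 1"
    and t: "card (verts F) \<le> t"
    and G: "simple_graph G" "v \<in> verts G"
    and K: "has_multipartite G r t (nbrs G v \<inter> verts G - Z)"
  shows "\<exists>f. embedding f F G \<and> f ` verts F \<subseteq> insert v (verts G - Z)"
proof -
  obtain S where S: "multipartite_in G r S (nbrs G v \<inter> verts G - Z)" "\<And>i. i < r \<Longrightarrow> card (S i) = t"
    using K unfolding has_multipartite_def by blast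
  obtain u c where c: "u \<in> verts F" "proper_colouring F (Suc r) c" "{x \<in> verts F. c x = r} = {u}"
    using critical_colouring[OF F] by blast
  have finG: "finite (verts G)" using G(1) by (simp add: simple_graph_def)
  have SA: "S i \<subseteq> nbrs G v \<inter> verts G - Z" if "i < r" for i
    using S(1) that by (auto simp: multipartite_in_def)
  have edge: "{x, y} \<in> edges G" if "x \<in> S i" "y \<in> S j" "i < r" "j < r" "i \<noteq> j" for x y i j
    using S(1) that unfolding multipartite_in_def by blast
  have edge2: "{v, x} \<in> edges G" if "x \<in> S i" "i < r" for x i
    using SA that by (auto simp: nbrs_def)
  have "\<exists>f. embedding f F G \<and> (\<forall>x\<in>verts F. f x \<in> (S(r := {v})) (c x))"
  proof (rule embedding_colour_classes[OF F(1) c(2) _ _ G(1)])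
    show "multipartite_in G (Suc r) (S(r := {v})) (verts G)"
      unfolding multipartite_in_def
    proof (intro conjI allI impI ballI)
      fix i assume "i < Suc r"
      then show "(S(r := {v})) i \<subseteq> verts G" using SA[of i] G(2) by (cases "i = r") auto
    next
      fix i j x y assume "i < Suc r" "j < Suc r" "i \<noteq> j" "x \<in> (S(r := {v})) i" "y \<in> (S(r := {v})) j"
      then show "{x, y} \<in> edges G"
        using edge[of x i y j] edge2[of x i] edge2[of y j]
        by (auto simp: less_Suc_eq insert_commute split: if_splits)
    qed
    show "finite ((S(r := {v})) i)" if "i < Suc r" for i
      using that SA finG by (cases "i = r") (auto simp: less_Suc_eq intro: finite_subset)
    have "card {x \<in> verts F. c x = i} \<le> t" for i
      using t F(1) card_mono[of "verts F" "{x \<in> verts F. c x = i}"] by (auto simp: simple_graph_def)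
    then show "card {x \<in> verts F. c x = i} \<le> card ((S(r := {v})) i)" if "i < Suc r" for i
      using that c(3) S(2) by (cases "i = r") (auto simp: less_Suc_eq)
  qed
  then obtain f where f: "embedding f F G" "\<And>x. x \<in> verts F \<Longrightarrow> f x \<in> (S(r := {v})) (c x)" by blast
  have "f x \<in> insert v (verts G - Z)" if x: "x \<in> verts F" for x
  proof -
    have "c x < Suc r" using c(2) x by (auto simp: proper_colouring_def)
    then show ?thesis using f(2)[OF x] SA[of "c x"] by (cases "c x = r") (auto simp: less_Suc_eq)
  qed
  then show ?thesis using f(1) by blast
qed

text \<open>\<open>ex_number\<close> maximises over graphs on the naturals; this carries its bounds
  to graphs on any type, such as the sum type of a join.\<close>

lemma nat_copy:
  fixes G :: "'a graph"
  assumes G: "simple_graph G"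
  obtains H :: "nat graph" where "simple_graph H" "card (verts H) = card (verts G)"
    "card (edges H) = card (edges G)" "\<And>F :: 'f graph. simple_graph F \<Longrightarrow> graph_free F G \<Longrightarrow> graph_free F H"
proof -
  have fin: "finite (verts G)" using G by (simp add: simple_graph_def)
  obtain c :: "'a \<Rightarrow> nat" where c: "inj_on c (verts G)"
    using fin finite_imp_inj_to_nat_seg by blast
  define H where "H = \<lparr>verts = c ` verts G, edges = (\<lambda>e. c ` e) ` edges G\<rparr>"
  have sub: "e \<subseteq> verts G" "card e = 2" if "e \<in> edges G" for e
    using G that by (auto simp: simple_graph_def)
  have H: "simple_graph H"
    using G sub c by (auto simp: simple_graph_def H_def card_image inj_on_subset)
  have inj: "inj_on (\<lambda>e. c ` e) (edges G)"
    using c sub(1) by (intro inj_onI) (metis inj_on_image_eq_iff)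
  have inv: "embedding (the_inv_into (verts G) c) H G"
    unfolding embedding_def
  proof (intro conjI ballI)
    show "inj_on (the_inv_into (verts G) c) (verts H)"
      using c by (simp add: H_def inj_on_the_inv_into)
    show "the_inv_into (verts G) c ` verts H \<subseteq> verts G"
      using c by (auto simp: H_def the_inv_into_f_f)
    fix e assume "e \<in> edges H"
    then obtain d where d: "d \<in> edges G" "e = c ` d" by (auto simp: H_def)
    then have "the_inv_into (verts G) c ` e = d"
      using sub(1)[OF d(1)] c unfolding d(2) image_image by (force simp: the_inv_into_f_f)
    then show "the_inv_into (verts G) c ` e \<in> edges G" using d by simp
  qed
  show thesis
  proof (rule that[OF H])
    show "card (verts H) = card (verts G)" using c by (simp add: H_def card_image)
    show "card (edges H) = card (edges G)" using inj by (simp add: H_def card_image)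
    fix F :: "'f graph" assume "simple_graph F" "graph_free F G"
    then show "graph_free F H" using inv embedding_trans by (metis graph_free_iff)
  qed
qed

text \<open>There are infinitely many graphs on \<open>n\<close> natural numbers, but their edge
  counts are at most n^2.\<close>

lemma finite_ex_set:
  "finite {card (edges G) | G :: nat graph. simple_graph G \<and> card (verts G) = n \<and> graph_free F G}"
proof (rule finite_subset)
  show "{card (edges G) | G :: nat graph. simple_graph G \<and> card (verts G) = n \<and> graph_free F G} \<subseteq> {..n\<^sup>2}"
  proof clarsimp
    fix G :: "nat graph" assume G: "simple_graph G" "n = card (verts G)"
    then show "card (edges G) \<le> (card (verts G))\<^sup>2"
      using card_edges_in_le_square[OF G(1), of "verts G"]
      by (simp add: edges_in_verts simple_graph_def)
  qed
qed simp

lemma card_edges_le_ex_number: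
  assumes "simple_graph F" "simple_graph G" "graph_free F G"
  shows "card (edges G) \<le> ex_number (card (verts G)) F"
proof -
  obtain H :: "nat graph" where "simple_graph H" "card (verts H) = card (verts G)"
    "card (edges H) = card (edges G)" "graph_free F H"
    using nat_copy[OF assms(2)] assms by metis
  then show ?thesis unfolding ex_number_def
    by (intro Max_ge finite_ex_set) force
qed

text \<open>\<open>Max\<close> says something only about a nonempty set, hence the witness
  \<open>G0\<close>: below, a Turan graph or a join construction.\<close>

lemma ex_number_attained:
  assumes "simple_graph F" "simple_graph G0" "graph_free F G0"
  obtains G :: "nat graph" where "G \<in> extremal_graphs (card (verts G0)) F"
proof -
  let ?X = "{card (edges G) | G :: nat graph. simple_graph G \<and> card (verts G) = card (verts G0) \<and> graph_free F G}"
  obtain H :: "nat graph" where "simple_graph H" "card (verts H) = card (verts G0)" "graph_free F H"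
    using nat_copy[OF assms(2)] assms by metis
  then have "?X \<noteq> {}" by blast
  then have "Max ?X \<in> ?X" using finite_ex_set by (rule Max_in[rotated])
  then obtain G :: "nat graph" where "simple_graph G" "card (verts G) = card (verts G0)" "graph_free F G"
    "card (edges G) = Max ?X" by (auto simp del: Max_in)
  then show thesis using that[of G] by (simp add: extremal_graphs_def ex_number_def)
qed

section \<open>The Turan graph as a lower bound for the extremal number\<close>

definition turan_graph :: "nat \<Rightarrow> nat \<Rightarrow> nat graph" where
  "turan_graph r n = \<lparr>verts = {..<n}, edges = {{u, v} | u v. u < n \<and> v < n \<and> u mod r \<noteq> v mod r}\<rparr>"

lemma simple_turan_graph: "simple_graph (turan_graph r n)"
  by (auto simp: simple_graph_def turan_graph_def card_2_iff)

lemma turan_graph_free: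
  assumes F: "simple_graph F" "chromatic_number F = r + 1" and r: "r > 0"
  shows "graph_free F (turan_graph r n)"
  unfolding graph_free_iff[OF F(1)]
proof clarify
  fix f assume f: "embedding f F (turan_graph r n)"
  have "proper_colouring F r (\<lambda>x. f x mod r)"
    unfolding proper_colouring_def
  proof (intro conjI allI impI)
    show "(\<lambda>x. f x mod r) ` verts F \<subseteq> {..<r}" using r by auto
    fix x y assume "{x, y} \<in> edges F"
    then have "f ` {x, y} \<in> edges (turan_graph r n)" using f unfolding embedding_def by blast
    then obtain a b where "{f x, f y} = {a, b}" "a mod r \<noteq> b mod r" by (auto simp: turan_graph_def)
    then show "f x mod r \<noteq> f y mod r" by (metis doubleton_eq_iff)
  qed
  then have "chromatic_number F \<le> r" unfolding chromatic_number_def by (intro Least_le) blast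
  then show False using F(2) by simp
qed

text \<open>Vertex \<open>n\<close> misses only the earlier vertices in its residue class, at most
  n/r + 1 of them. The linear error is harmless, since the bound serves only to verify quadratic
  density hypotheses.\<close>

lemma card_edges_turan_graph:
  assumes r: "r > 0"
  shows "(1 - 1 / r) * (real n)\<^sup>2 / 2 - 2 * real n \<le> card (edges (turan_graph r n))"
proof (induction n)
  case 0
  then show ?case by simp
next
  case (Suc n)
  let ?T = "turan_graph r (Suc n)"
  have "edges_in ?T ({..<Suc n} - {n}) = edges (turan_graph r n)" (is "?L = ?R")
  proof
    show "?L \<subseteq> ?R"
    proof
      fix e assume "e \<in> ?L"
      then obtain u v where "e = {u, v}" "u < Suc n" "v < Suc n" "u mod r \<noteq> v mod r" "u \<noteq> n" "v \<noteq> n"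
        by (auto simp: edges_in_def turan_graph_def)
      then show "e \<in> ?R" by (auto simp: turan_graph_def less_Suc_eq)
    qed
    show "?R \<subseteq> ?L" by (fastforce simp: edges_in_def turan_graph_def)
  qed
  then have "card (edges ?T) = card (edges (turan_graph r n)) + card (nbrs ?T n \<inter> {..<Suc n})"
    using card_edges_in_remove[OF simple_turan_graph, of "{..<Suc n}" n r "Suc n"]
      edges_in_verts[OF simple_turan_graph[of r "Suc n"]] by (simp add: turan_graph_def)
  moreover have "real n - (n / r + 1) \<le> card (nbrs ?T n \<inter> {..<Suc n})"
  proof -
    let ?B = "{v. v < n \<and> v mod r = n mod r}"
    have "inj_on (\<lambda>v. v div r) ?B"
      by (intro inj_onI) (metis (mono_tags, lifting) div_mult_mod_eq mem_Collect_eq)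
    moreover have "(\<lambda>v. v div r) ` ?B \<subseteq> {..n div r}"
      by (auto intro: div_le_mono)
    ultimately have "card ?B \<le> card {..n div r}" by (meson card_inj_on_le finite_atMost)
    then have "card ?B \<le> n div r + 1" by simp
    then have "real (card ?B) \<le> real (n div r) + 1" by linarith
    also have "real (n div r) \<le> n / r" by (rule of_nat_div_le_of_nat)
    finally have B: "real (card ?B) \<le> n / r + 1" by simp
    have "{..<n} - ?B \<subseteq> nbrs ?T n \<inter> {..<Suc n}"
    proof
      fix v assume "v \<in> {..<n} - ?B"
      then have "v < n" "n mod r \<noteq> v mod r" by auto
      then have "\<exists>a b. {n, v} = {a, b} \<and> a < Suc n \<and> b < Suc n \<and> a mod r \<noteq> b mod r"
        by (intro exI[of _ n] exI[of _ v]) auto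
      then show "v \<in> nbrs ?T n \<inter> {..<Suc n}"
        using \<open>v < n\<close> by (simp add: nbrs_def turan_graph_def)
    qed
    then have "card ({..<n} - ?B) \<le> card (nbrs ?T n \<inter> {..<Suc n})" by (intro card_mono) auto
    moreover have "n - card ?B \<le> card ({..<n} - ?B)"
      using diff_card_le_card_Diff[of ?B "{..<n}"] by simp
    ultimately show ?thesis using B by linarith
  qed
  moreover have "(1 - 1 / r) * (real (Suc n))\<^sup>2 / 2 - 2 * real (Suc n) \<le>
      (1 - 1 / r) * (real n)\<^sup>2 / 2 - 2 * real n + (real n - (n / r + 1))"
  proof -
    have "(1 - 1 / r) * (real (Suc n))\<^sup>2 / 2 = (1 - 1 / r) * (real n)\<^sup>2 / 2 + (1 - 1 / r) * n + (1 - 1 / r) / 2"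
      by (simp add: power2_eq_square algebra_simps add_divide_distrib diff_divide_distrib)
    moreover have "(1 - 1 / r) * n = n - n / r" by (simp add: algebra_simps)
    moreover have "- (2 / real r) \<le> 2" using order_trans[of "- (2 / real r)" 0 2] by simp
    ultimately show ?thesis by simp
  qed
  ultimately show ?case using Suc.IH by linarith
qed

lemma ex_number_ge_turan:
  assumes "simple_graph F" "chromatic_number F = r + 1" "r > 0"
  shows "(1 - 1 / r) * (real n)\<^sup>2 / 2 - 2 * real n \<le> ex_number n F"
proof -
  have "card (edges (turan_graph r n)) \<le> ex_number (card (verts (turan_graph r n))) F"
    using assms by (intro card_edges_le_ex_number turan_graph_free simple_turan_graph)
  then show ?thesis using card_edges_turan_graph[OF assms(3), of n] by (simp add: turan_graph_def)
qed

section \<open>Growth of the extremal number\<close>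

text \<open>Used in contraposition: it provides the absence of K_(r+1)(t) in graphs that are free of
  \<open>F\<close> or of the union.\<close>

lemma multipartite_embedding:
  assumes F: "simple_graph F" "proper_colouring F q c" "card (verts F) \<le> t"
    and G: "simple_graph G" "has_multipartite G q t (verts G)"
  shows "\<exists>f. embedding f F G"
proof -
  obtain S where S: "multipartite_in G q S (verts G)" "\<And>i. i < q \<Longrightarrow> card (S i) = t"
    using G(2) unfolding has_multipartite_def by blast
  have fin: "finite (S i)" if "i < q" for i
    using S(1) G(1) that by (auto simp: multipartite_in_def simple_graph_def intro: finite_subset)
  have "card {x \<in> verts F. c x = i} \<le> card (verts F)" for i
    using F(1) by (intro card_mono) (auto simp: simple_graph_def)
  then have "card {x \<in> verts F. c x = i} \<le> card (S i)" if "i < q" for i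
    unfolding S(2)[OF that] using F(3) by (rule le_trans)
  then show ?thesis using embedding_colour_classes[OF F(1,2) S(1) fin G(1)] by blast
qed

text \<open>In a copy of \<open>F\<close>, the new vertex could be exchanged for an unused vertex of \<open>S\<close> adjacent to
  all its neighbours.\<close>

lemma ex_number_add_vertex:
  fixes H :: "nat graph"
  assumes F: "simple_graph F" "card (verts F) = t"
    and H: "simple_graph H" "graph_free F H"
    and S: "S \<subseteq> verts H" "2 * t \<le> card S" "t > 0"
    and Q: "Q \<subseteq> verts H" "\<And>x. x \<in> Q \<Longrightarrow> 2 * t * card (S - nbrs H x) \<le> card S"
  shows "card (edges H) + card Q \<le> ex_number (card (verts H) + 1) F"
proof -
  have finH: "finite (verts H)" using H(1) by (simp add: simple_graph_def)
  then obtain z where z: "z \<notin> verts H" using ex_new_if_finite infinite_UNIV_nat by blast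
  have finS: "finite S" using S(1) finH finite_subset by blast
  have finQ: "finite Q" using Q(1) finH finite_subset by blast
  define H' where "H' = \<lparr>verts = insert z (verts H), edges = edges H \<union> (\<lambda>x. {z, x}) ` Q\<rparr>"
  have eH: "z \<notin> e" if "e \<in> edges H" for e using H(1) that z by (auto simp: simple_graph_def)
  have H': "simple_graph H'"
    using H(1) z Q(1) finH by (auto simp: simple_graph_def H'_def card_insert_if)
  have "edges H \<inter> (\<lambda>x. {z, x}) ` Q = {}" using eH by auto
  moreover have "inj_on (\<lambda>x. {z, x}) Q" by (auto simp: inj_on_def doubleton_eq_iff)
  ultimately have card': "card (edges H') = card (edges H) + card Q"
    using finite_edges[OF H(1)] finQ by (simp add: H'_def card_Un_disjoint card_image)
  have "graph_free F H'"
    unfolding graph_free_iff[OF F(1)]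
  proof clarify
    fix f assume f: "embedding f F H'"
    have inj: "inj_on f (verts F)" and img: "f ` verts F \<subseteq> insert z (verts H)"
      using f by (auto simp: embedding_def H'_def)
    have no: "\<not> embedding g F H" for g using H(2) graph_free_iff[OF F(1)] by blast
    show False
    proof (cases "z \<in> f ` verts F")
      case False
      have "f ` e \<in> edges H" if "e \<in> edges F" for e
      proof -
        have "f ` e \<in> edges H'" using f that unfolding embedding_def by blast
        moreover have "z \<notin> f ` e" using False that F(1) by (auto simp: simple_graph_def)
        ultimately show ?thesis by (auto simp: H'_def)
      qed
      then have "embedding f F H" using inj img False by (auto simp: embedding_def)
      then show False using no by blast
    next
      case True
      then obtain u where u: "u \<in> verts F" "f u = z" by auto
      define Y where "Y = f ` (verts F - {u})"
      have finF: "finite (verts F)" using F(1) by (simp add: simple_graph_def)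
      have injY: "inj_on f (verts F - {u})" using inj by (rule inj_on_subset) auto
      have cardY: "card Y = t - 1" unfolding Y_def card_image[OF injY] using u(1) F(2) by simp
      have finY: "finite Y" using finF by (simp add: Y_def)
      have zY: "z \<notin> Y" using inj u by (auto simp: Y_def inj_on_def)
      then have YH: "Y \<subseteq> verts H" using img by (auto simp: Y_def)
      \<comment> \<open>A replacement for \<open>z\<close> in \<open>S\<close> must avoid
        \<open>?bad\<close> (adjacency) and \<open>Y\<close> (injectivity). Each of the at most t -
        1 vertices of \<open>Y\<close> in \<open>Q\<close> rules out at most |S|/(2t) candidates,
        and |Y| = t - 1 is below |S|/2, so together they do not exhaust \<open>S\<close>.\<close>
      let ?bad = "\<Union>x\<in>Y \<inter> Q. S - nbrs H x"
      have "2 * t * card ?bad \<le> 2 * t * (\<Sum>x\<in>Y \<inter> Q. card (S - nbrs H x))"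
        using finY by (intro mult_left_mono card_UN_le) auto
      also have "\<dots> = (\<Sum>x\<in>Y \<inter> Q. 2 * t * card (S - nbrs H x))" by (simp add: sum_distrib_left)
      also have "\<dots> \<le> of_nat (card (Y \<inter> Q)) * card S"
        using Q(2) by (intro sum_bounded_above) auto
      also have "\<dots> \<le> (t - 1) * card S"
        using card_mono[OF finY, of "Y \<inter> Q"] cardY by simp
      finally have "2 * t * card ?bad \<le> (t - 1) * card S" .
      moreover have "2 * t * card Y < t * card S + card S"
      proof -
        have "2 * t * card Y \<le> card S * (t - 1)" using S(2) cardY by (intro mult_mono) auto
        also have "card S * (t - 1) \<le> t * card S" by (simp add: mult.commute)
        finally show ?thesis using S(2,3) by linarith
      qed
      ultimately have "2 * t * card ?bad + 2 * t * card Y < 2 * t * card S"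
        using S(3) by (cases t) (auto simp: algebra_simps)
      then have "card ?bad + card Y < card S"
        by (metis distrib_left mult_less_cancel1)
      then have "card (?bad \<union> Y) < card S" using card_Un_le[of ?bad Y] by linarith
      then obtain s where s: "s \<in> S" "s \<notin> ?bad \<union> Y"
        by (meson card_mono finS finY finite_Un finite_UN finite_Int finite_Diff not_le subsetI)
      define g where "g = f(u := s)"
      have gf: "g x = f x" if "x \<noteq> u" for x using that by (simp add: g_def)
      have "inj_on g (verts F)"
        using inj s(2) by (auto simp: inj_on_def g_def Y_def)
      moreover have "g ` verts F \<subseteq> verts H"
        using YH s(1) S(1) by (auto simp: g_def Y_def)
      moreover have "g ` e \<in> edges H" if e: "e \<in> edges F" for e
      proof -
        have fe: "f ` e \<in> edges H'" using f e unfolding embedding_def by blast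
        have e2: "e \<subseteq> verts F" "card e = 2" using F(1) e by (auto simp: simple_graph_def)
        show ?thesis
        proof (cases "u \<in> e")
          case False
          then have "g ` e = f ` e" by (intro image_cong refl gf) auto
          moreover have "z \<notin> f ` e" using False e2 zY by (auto simp: Y_def)
          ultimately show ?thesis using fe by (auto simp: H'_def)
        next
          case True
          then obtain y where y: "e = {u, y}" "y \<noteq> u" "y \<in> verts F"
            using e2 by (auto simp: card_2_iff)
          have "{z, f y} \<in> edges H'" using fe y u by simp
          then have "f y \<in> Q" using eH by (auto simp: H'_def doubleton_eq_iff)
          moreover have "f y \<in> Y" using y by (auto simp: Y_def)
          ultimately have "s \<in> nbrs H (f y)" using s by blast
          then show ?thesis using y by (simp add: g_def nbrs_def insert_commute)
        qed
      qed
      ultimately have "embedding g F H" by (auto simp: embedding_def)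
      then show False using no by blast
    qed
  qed
  then have "card (edges H') \<le> ex_number (card (verts H')) F"
    using F(1) H' by (intro card_edges_le_ex_number)
  then show ?thesis using card' z finH by (simp add: H'_def)
qed

text \<open>In a copy of \<open>K\<^sub>r(M)\<close> with large \<open>M\<close>, every vertex has fewer than \<open>t\<close> neighbours in some class,
  so by double counting almost every vertex is adjacent to nearly all of the other classes.\<close>

lemma ex_number_growth:
  fixes F :: "'f graph" and \<epsilon> :: real
  assumes F: "simple_graph F" "vertex_critical F" "chromatic_number F = r + 1" and r: "r \<ge> 2"
    and eps: "\<epsilon> > 0" "\<epsilon> \<le> 1"
  shows "\<exists>N0. \<forall>N\<ge>N0. ex_number N F + (1 - 1 / r - \<epsilon>) * N \<le> ex_number (N + 1) F"
proof -
  define t where "t = card (verts F)"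
  obtain u0 where "u0 \<in> verts F" using F(2) by (auto simp: vertex_critical_def)
  then have t: "t > 0" using F(1) by (auto simp: t_def simple_graph_def card_gt_0_iff)
  define a where "a = 1 - 1 / real r"
  have a0: "1 / 2 \<le> a" "a \<le> 1" using r by (auto simp: a_def field_simps)
  have ra: "real r * a = real r - 1" using r by (simp add: a_def field_simps)
  \<comment> \<open>The second bound lifts the minimum degree in \<open>A\<close> above the
    threshold for K_r(M); the first keeps the degree error small in the double counting.\<close>
  define \<epsilon>1 where "\<epsilon>1 = min (\<epsilon> / (8 * t)) (1 / (2 * (real r)\<^sup>2))"
  have r2: "1 / (2 * (real r)\<^sup>2) \<le> 1 / 8"
    using r power_mono[of 2 "real r" 2] by (simp add: field_simps)
  have e1: "0 < \<epsilon>1" "\<epsilon>1 \<le> \<epsilon> / (8 * t)" "\<epsilon>1 \<le> 1 / (2 * (real r)\<^sup>2)" "\<epsilon>1 \<le> 1 / 8"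
    using eps t r order_trans[OF min.cobounded2 r2] by (auto simp: \<epsilon>1_def)
  \<comment> \<open>\<open>M\<close> makes \<open>t\<close> negligible against \<epsilon>M/t, and
    \<open>2 * t \<le> M\<close> is what the exchange of the new vertex requires.\<close>
  obtain M0 where M0: "\<And>M. M \<ge> M0 \<Longrightarrow> 4 * (real t)\<^sup>2 / \<epsilon> < real M" using less_of_nat_large by blast
  define M where "M = max M0 (2 * t)"
  have M: "4 * (real t)\<^sup>2 \<le> \<epsilon> * M" "2 * t \<le> M" "M > 0"
    using M0[of M] eps t by (auto simp: M_def field_simps)
  obtain \<delta> n1 where d: "\<delta> > 0" and n1: "\<And>(G :: nat graph) V. simple_graph G \<Longrightarrow> finite V \<Longrightarrow> n1 \<le> card V \<Longrightarrow>
           (1 - 1 / r - \<delta>) * (card V)\<^sup>2 / 2 \<le> card (edges_in G V) \<Longrightarrow>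
           \<not> has_multipartite G (Suc r) t V \<Longrightarrow>
           (\<exists>A\<subseteq>V. (1 - \<epsilon>1) * card V \<le> card A \<and>
              (\<forall>x\<in>A. (1 - 1 / r - \<epsilon>1) * card A \<le> card (nbrs G x \<inter> A)))"
  proof -
    have "r \<ge> 1" "\<epsilon>1 \<le> 1" using r e1(4) by auto
    from almost_regular_subset[OF this(1) e1(1) this(2), of t, where 'a = nat] that show thesis by blast
  qed
  have "\<exists>n0. \<forall>(G :: nat graph) A. simple_graph G \<longrightarrow> finite A \<longrightarrow> n0 \<le> card A \<longrightarrow>
      (\<forall>x\<in>A. (1 - 1 / (r - 1 :: nat) + 1 / (2 * (real r)\<^sup>2)) * card A \<le> card (nbrs G x \<inter> A)) \<longrightarrow>
      has_multipartite G (Suc (r - 1)) M A"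
    using r by (intro min_degree_has_multipartite) auto
  then obtain n2 where n2: "\<And>(G :: nat graph) A. simple_graph G \<Longrightarrow> finite A \<Longrightarrow> n2 \<le> card A \<Longrightarrow>
      (\<forall>x\<in>A. (1 - 1 / (real r - 1) + 1 / (2 * (real r)\<^sup>2)) * card A \<le> card (nbrs G x \<inter> A)) \<Longrightarrow>
      has_multipartite G r M A"
    using r by (auto simp: of_nat_diff)
  have rr: "1 - 1 / (real r - 1) + 1 / (2 * (real r)\<^sup>2) \<le> a - \<epsilon>1"
  proof -
    have "1 / (real r - 1) - 1 / real r = 1 / (real r * (real r - 1))" using r by (simp add: field_simps)
    moreover have "1 / (real r)\<^sup>2 \<le> 1 / (real r * (real r - 1))"
      using r by (intro divide_left_mono) (auto simp: power2_eq_square)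
    moreover have "1 / (real r)\<^sup>2 = 1 / (2 * (real r)\<^sup>2) + 1 / (2 * (real r)\<^sup>2)" by simp
    moreover have "y - x = w \<Longrightarrow> p \<le> w \<Longrightarrow> p = q + q \<Longrightarrow> e \<le> q \<Longrightarrow> 1 - y + q \<le> 1 - x - e"
      for x y w p q e :: real by linarith
    ultimately show ?thesis unfolding a_def using e1(3) by blast
  qed
  obtain n3 where n3: "\<And>n. n \<ge> n3 \<Longrightarrow> 4 / \<delta> + 2 * real n2 < real n" using less_of_nat_large by blast
  show ?thesis
  proof (intro exI[of _ "max n1 n3"] allI impI)
    fix N assume N: "max n1 n3 \<le> N"
    have Nn: "4 / \<delta> + 2 * real n2 < N" using n3 N by auto
    obtain H :: "nat graph" where "H \<in> extremal_graphs (card (verts (turan_graph r N))) F"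
      using ex_number_attained[OF F(1) simple_turan_graph turan_graph_free[OF F(1,3)]] r
      by (metis gr0I not_numeral_le_zero)
    then have H: "simple_graph H" "card (verts H) = N" "graph_free F H" "card (edges H) = ex_number N F"
      by (auto simp: extremal_graphs_def turan_graph_def)
    define V where "V = verts H"
    have finV: "finite V" using H(1) by (simp add: V_def simple_graph_def)
    have noemb: "\<not> embedding f F H" for f using H(3) graph_free_iff[OF F(1)] by blast
    have noK: "\<not> has_multipartite H (Suc r) t V"
    proof
      assume "has_multipartite H (Suc r) t V"
      moreover obtain c where "proper_colouring F (Suc r) c"
        using chromatic_number_colouring[OF F(1)] F(3) by auto
      ultimately show False
        using multipartite_embedding[OF F(1) _ _ H(1)] noemb by (auto simp: V_def t_def)
    qed
    have dense: "(1 - 1 / r - \<delta>) * (card V)\<^sup>2 / 2 \<le> card (edges_in H V)"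
    proof -
      have "(1 - 1 / r) * (real N)\<^sup>2 / 2 - 2 * real N \<le> ex_number N F"
        using ex_number_ge_turan[OF F(1,3), of N] r by simp
      moreover have "2 * real N \<le> \<delta> * (real N)\<^sup>2 / 2"
      proof -
        have "4 / \<delta> \<le> N" using Nn by linarith
        then have "4 \<le> \<delta> * N" using d by (simp add: field_simps)
        then have "4 * real N \<le> \<delta> * N * N" by (intro mult_right_mono) auto
        then show ?thesis by (simp add: power2_eq_square)
      qed
      moreover have "(1 - 1 / r - \<delta>) * (real N)\<^sup>2 / 2 = (1 - 1 / r) * (real N)\<^sup>2 / 2 - \<delta> * (real N)\<^sup>2 / 2"
        by (simp add: algebra_simps diff_divide_distrib)
      ultimately have "(1 - 1 / r - \<delta>) * (real N)\<^sup>2 / 2 \<le> ex_number N F" by linarith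
      then show ?thesis using H by (simp add: V_def edges_in_verts)
    qed
    obtain A where A: "A \<subseteq> V" "(1 - \<epsilon>1) * card V \<le> card A"
        "\<And>x. x \<in> A \<Longrightarrow> (a - \<epsilon>1) * card A \<le> card (nbrs H x \<inter> A)"
      using n1[OF H(1) finV _ dense noK] N H(2) by (auto simp: V_def a_def)
    have finA: "finite A" using A(1) finV finite_subset by blast
    have AN: "(1 - \<epsilon>1) * N \<le> card A" using A(2) H(2) by (simp add: V_def)
    have "1 / 2 * real N \<le> (1 - \<epsilon>1) * N" using e1 by (intro mult_right_mono) auto
    moreover have "0 < 4 / \<delta>" using d by simp
    ultimately have "n2 \<le> card A" using AN Nn by linarith
    moreover have "(1 - 1 / (real r - 1) + 1 / (2 * (real r)\<^sup>2)) * card A \<le> card (nbrs H x \<inter> A)"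
      if "x \<in> A" for x
    proof -
      have "(1 - 1 / (real r - 1) + 1 / (2 * (real r)\<^sup>2)) * card A \<le> (a - \<epsilon>1) * card A"
        using rr by (intro mult_right_mono) auto
      then show ?thesis using A(3)[OF that] by linarith
    qed
    ultimately have "has_multipartite H r M A" using H(1) finA by (intro n2) auto
    then obtain S where S: "multipartite_in H r S A" "\<And>i. i < r \<Longrightarrow> card (S i) = M"
      unfolding has_multipartite_def by blast
    have SA: "S i \<subseteq> A" if "i < r" for i using S(1) that by (auto simp: multipartite_in_def)
    have finS: "finite (S i)" if "i < r" for i using SA[OF that] finA finite_subset by blast
    define dg where "dg x i = card (nbrs H x \<inter> S i)" for x i
    \<comment> \<open>\<open>ex_number_add_vertex\<close> tolerates |S|/(2t) non-neighbours in
      \<open>S\<close>, which is \<eta>M for a part \<open>S i\<close>.\<close>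
    define \<eta> where "\<eta> = 1 / (2 * real t)"
    have eta: "0 < \<eta>" "\<eta> \<le> 1" using t by (auto simp: \<eta>_def field_simps)
    define good where "good i = {x \<in> V. (1 - \<eta>) * M \<le> dg x i}" for i
    have dM: "dg x i \<le> M" if "i < r" for x i
      unfolding dg_def using S(2)[OF that] finS[OF that] by (metis card_mono inf_le2)
    \<comment> \<open>With \<open>t\<close> neighbours in every part, \<open>x\<close> would host a
      copy of \<open>F\<close> by criticality.\<close>
    have small: "\<exists>k<r. dg x k < t" if x: "x \<in> V" for x
    proof (rule ccontr)
      assume "\<not> ?thesis"
      then have "t \<le> card (nbrs H x \<inter> S i)" if "i < r" for i
        using that unfolding dg_def by (meson not_less)
      then have "\<exists>R. R \<subseteq> nbrs H x \<inter> S i \<and> card R = t" if "i < r" for i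
        using that by (meson obtain_subset_with_card_n)
      then obtain R where R: "\<And>i. i < r \<Longrightarrow> R i \<subseteq> nbrs H x \<inter> S i \<and> card (R i) = t" by metis
      have "multipartite_in H r R (nbrs H x \<inter> verts H - {})"
        unfolding multipartite_in_def
      proof (intro conjI allI impI ballI)
        fix i assume "i < r"
        then show "R i \<subseteq> nbrs H x \<inter> verts H - {}" using R[of i] SA[of i] A(1) by (auto simp: V_def)
      next
        fix i j y z assume "i < r" "j < r" "i \<noteq> j" "y \<in> R i" "z \<in> R j"
        then show "{y, z} \<in> edges H" using R[of i] R[of j] S(1) unfolding multipartite_in_def by blast
      qed
      then have "has_multipartite H r t (nbrs H x \<inter> verts H - {})"
        using R unfolding has_multipartite_def by blast
      then show False using critical_embedding[OF F _ H(1)] x noemb by (metis V_def t_def order_refl)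
    qed
    \<comment> \<open>Double counting of the adjacencies between the K_r(M) and \<open>V\<close>:
      its r * M vertices lie in \<open>A\<close> and so have degree nearly a * N.\<close>
    have "real r * M * ((a - 2 * \<epsilon>1) * N) = (\<Sum>i<r. \<Sum>s\<in>S i. (a - 2 * \<epsilon>1) * N)"
      using S(2) by simp
    also have "\<dots> \<le> (\<Sum>i<r. \<Sum>s\<in>S i. real (card (nbrs H s \<inter> V)))"
    proof (intro sum_mono)
      fix i s assume "i \<in> {..<r}" "s \<in> S i"
      then have s: "s \<in> A" using SA by auto
      have "(a - \<epsilon>1) * ((1 - \<epsilon>1) * N) \<le> (a - \<epsilon>1) * card A"
        using AN a0 e1 by (intro mult_left_mono) auto
      moreover have "card (nbrs H s \<inter> A) \<le> card (nbrs H s \<inter> V)"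
        using A(1) finV by (intro card_mono) auto
      moreover have "(a - 2 * \<epsilon>1) * N \<le> (a - \<epsilon>1) * ((1 - \<epsilon>1) * N)"
      proof -
        have "\<epsilon>1 * a \<le> \<epsilon>1" using a0 e1 by simp
        moreover have "(a - \<epsilon>1) * (1 - \<epsilon>1) = a - \<epsilon>1 - \<epsilon>1 * a + \<epsilon>1 * \<epsilon>1"
          by (simp add: algebra_simps)
        moreover have "0 \<le> \<epsilon>1 * \<epsilon>1" by simp
        ultimately have "a - 2 * \<epsilon>1 \<le> (a - \<epsilon>1) * (1 - \<epsilon>1)" by linarith
        then have "(a - 2 * \<epsilon>1) * N \<le> (a - \<epsilon>1) * (1 - \<epsilon>1) * N" by (intro mult_right_mono) auto
        then show ?thesis by (simp add: mult.assoc)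
      qed
      ultimately show "(a - 2 * \<epsilon>1) * N \<le> card (nbrs H s \<inter> V)" using A(3)[OF s] by linarith
    qed
    also have "\<dots> = real (\<Sum>i<r. \<Sum>x\<in>V. dg x i)"
      unfolding dg_def using sum_card_nbrs_swap[OF finS finV, of _ H] by (simp flip: of_nat_sum)
    also have "\<dots> = (\<Sum>x\<in>V. \<Sum>i<r. real (dg x i))"
      by (subst sum.swap) simp
    \<comment> \<open>One part contributes less than \<open>t\<close> to \<open>x\<close>; every
      other part contributes at most (1 - \<eta>)M, and \<eta>M more only if \<open>x\<close> is
      good for it.\<close>
    also have "\<dots> \<le> (\<Sum>x\<in>V. t + (real r - 1) * ((1 - \<eta>) * M) + \<eta> * M * (\<Sum>i<r. if x \<in> good i then 1 else 0))"
    proof (rule sum_mono)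
      fix x assume x: "x \<in> V"
      obtain k where k: "k < r" "dg x k < t" using small[OF x] by blast
      have "(\<Sum>i<r. real (dg x i)) = dg x k + (\<Sum>i\<in>{..<r} - {k}. real (dg x i))"
        using k(1) by (simp add: sum.remove)
      also have "(\<Sum>i\<in>{..<r} - {k}. real (dg x i)) \<le>
          (\<Sum>i\<in>{..<r} - {k}. (1 - \<eta>) * M + \<eta> * M * (if x \<in> good i then 1 else 0))"
      proof (rule sum_mono)
        fix i assume "i \<in> {..<r} - {k}"
        then have "real (dg x i) \<le> M" using dM by simp
        then show "real (dg x i) \<le> (1 - \<eta>) * M + \<eta> * M * (if x \<in> good i then 1 else 0)"
          using x by (auto simp: good_def algebra_simps)
      qed
      also have "\<dots> = (real r - 1) * ((1 - \<eta>) * M) +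
          \<eta> * M * (\<Sum>i\<in>{..<r} - {k}. if x \<in> good i then 1 else 0)"
        using k(1) by (simp add: sum.distrib sum_distrib_left of_nat_diff del: sum.If_cases)
      also have "(\<Sum>i\<in>{..<r} - {k}. if x \<in> good i then 1 else 0) \<le> (\<Sum>i<r. if x \<in> good i then 1 else 0 :: real)"
        by (intro sum_mono2) auto
      finally show "(\<Sum>i<r. real (dg x i)) \<le>
          t + (real r - 1) * ((1 - \<eta>) * M) + \<eta> * M * (\<Sum>i<r. if x \<in> good i then 1 else 0)"
        using k(2) eta(1) by (simp add: mult_left_mono)
    qed
    also have "\<dots> = N * (t + (real r - 1) * ((1 - \<eta>) * M)) + \<eta> * M * (\<Sum>i<r. real (card (good i)))"
    proof -
      have "real (card (good i)) = (\<Sum>x\<in>V. if x \<in> good i then 1 else 0)" for i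
      proof -
        have "V \<inter> good i = good i" by (auto simp: good_def)
        then show ?thesis using finV by (simp add: sum.If_cases)
      qed
      then have "(\<Sum>i<r. real (card (good i))) = (\<Sum>x\<in>V. \<Sum>i<r. if x \<in> good i then 1 else 0)"
        by (subst sum.swap) simp
      then show ?thesis using H(2) by (simp add: sum.distrib sum_distrib_left V_def)
    qed
    finally have main: "real r * M * ((a - 2 * \<epsilon>1) * N) \<le>
      N * (t + (real r - 1) * ((1 - \<eta>) * M)) + \<eta> * M * (\<Sum>i<r. real (card (good i)))" .
    \<comment> \<open>The degree error 2 * \<epsilon>1 * r * M * N and the error N * t from the poor
      part are each at most half of \<eta> * M * N * r * \<epsilon>.\<close>
    have "\<eta> * M * (real r * ((a - \<epsilon>) * N)) \<le> \<eta> * M * (\<Sum>i<r. real (card (good i)))"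
    proof -
      have "real r * M * ((a - 2 * \<epsilon>1) * N) = (real r - 1) * M * N - 2 * \<epsilon>1 * r * M * N"
        unfolding ra[symmetric] by (simp add: algebra_simps)
      moreover have "\<eta> * M * (real r * ((a - \<epsilon>) * N)) = \<eta> * M * N * (real r - 1) - \<eta> * M * N * (r * \<epsilon>)"
        unfolding ra[symmetric] by (simp add: algebra_simps)
      moreover have "N * (t + (real r - 1) * ((1 - \<eta>) * M)) = N * t + (real r - 1) * M * N - \<eta> * M * N * (real r - 1)"
        by (simp add: algebra_simps)
      moreover have "2 * \<epsilon>1 * r * M * N + N * t \<le> \<eta> * M * N * (r * \<epsilon>)"
      proof -
        have "2 * \<epsilon>1 * r * M \<le> 2 * (\<epsilon> / (8 * t)) * r * M"
          using e1 by (intro mult_right_mono mult_left_mono) auto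
        moreover have "2 * (\<epsilon> / (8 * t)) * r * M = \<eta> * M * (r * \<epsilon>) / 2" using t by (simp add: \<eta>_def)
        moreover have "real t \<le> \<eta> * M * (r * \<epsilon>) / 2"
        proof -
          have "4 * (real t)\<^sup>2 * 1 \<le> (\<epsilon> * M) * r" 
            using M(1) eps r by (intro mult_mono[of "4 * (real t)\<^sup>2"]) auto
          then show ?thesis using t by (simp add: \<eta>_def field_simps power2_eq_square)
        qed
        ultimately have "2 * \<epsilon>1 * r * M + t \<le> \<eta> * M * (r * \<epsilon>)" by linarith
        then have "(2 * \<epsilon>1 * r * M + t) * N \<le> \<eta> * M * (r * \<epsilon>) * N" by (intro mult_right_mono) auto
        then show ?thesis by (simp add: algebra_simps)
      qed
      ultimately show ?thesis using main by linarith
    qed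
    then have sum: "real r * ((a - \<epsilon>) * N) \<le> (\<Sum>i<r. real (card (good i)))"
      using eta M(3) by (simp add: mult_le_cancel_left_pos)
    have "\<exists>i<r. (a - \<epsilon>) * N \<le> card (good i)"
    proof (rule ccontr)
      assume "\<not> ?thesis"
      then have "(\<Sum>i<r. real (card (good i))) < (\<Sum>i<r. (a - \<epsilon>) * N)"
        using r by (intro sum_strict_mono) (auto simp: not_le lessThan_empty_iff)
      then show False using sum by simp
    qed
    then obtain i where i: "i < r" "(a - \<epsilon>) * N \<le> card (good i)" by blast
    have "card (edges H) + card (good i) \<le> ex_number (card (verts H) + 1) F"
    proof (rule ex_number_add_vertex[OF F(1) t_def[symmetric] H(1,3)])
      show "S i \<subseteq> verts H" using SA[OF i(1)] A(1) by (simp add: V_def)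
      show "2 * t \<le> card (S i)" using S(2)[OF i(1)] M(2) by simp
      show "t > 0" by (rule t)
      show "good i \<subseteq> verts H" by (auto simp: good_def V_def)
      fix x assume "x \<in> good i"
      then have g: "(1 - \<eta>) * M \<le> dg x i" by (simp add: good_def)
      have "card (S i - nbrs H x) = card (S i) - dg x i"
        unfolding dg_def using finS[OF i(1)] by (simp add: card_Diff_subset_Int Int_commute)
      then have "real (card (S i - nbrs H x)) = real M - dg x i"
        using S(2)[OF i(1)] dM[OF i(1), of x] by (simp add: of_nat_diff)
      then have "real (card (S i - nbrs H x)) \<le> \<eta> * M" using g by (simp add: algebra_simps)
      then have "2 * real t * real (card (S i - nbrs H x)) \<le> M" using t by (simp add: \<eta>_def field_simps)
      then have "real (2 * t * card (S i - nbrs H x)) \<le> real (card (S i))" using S(2)[OF i(1)] by simp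
      then show "2 * t * card (S i - nbrs H x) \<le> card (S i)" by linarith
    qed
    then have "real (card (edges H) + card (good i)) \<le> real (ex_number (N + 1) F)" using H(2) by simp
    then show "ex_number N F + (1 - 1 / r - \<epsilon>) * N \<le> ex_number (N + 1) F"
      using i(2) H(4) by (simp add: a_def)
  qed
qed

section \<open>Joins and packings\<close>

lemma simple_graph_join:
  assumes "simple_graph G" "simple_graph H"
  shows "simple_graph (graph_join G H)"
proof -
  have "card (Inl ` e :: ('a + 'b) set) = card e" for e by (simp add: card_image)
  moreover have "card (Inr ` e :: ('a + 'b) set) = card e" for e by (simp add: card_image)
  ultimately show ?thesis
    using assms by (auto simp: simple_graph_def graph_join_def card_insert_if)
qed

lemma simple_complete_graph: "simple_graph (complete_graph m)"
  by (auto simp: simple_graph_def complete_graph_def)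

lemma card_verts_join:
  assumes "simple_graph G" "simple_graph H"
  shows "card (verts (graph_join G H)) = card (verts G) + card (verts H)"
  using assms by (simp add: graph_join_def simple_graph_def card_Plus)

lemma card_edges_join_complete:
  assumes H: "simple_graph H"
  shows "card (edges (graph_join (complete_graph s) H)) =
    (s choose 2) + s * card (verts H) + card (edges H)"
proof -
  let ?A = "(\<lambda>e. Inl ` e) ` edges (complete_graph s) :: (nat + 'a) set set"
  let ?B = "(\<lambda>e. Inr ` e) ` edges H :: (nat + 'a) set set"
  let ?C = "(\<lambda>(u, v). {Inl u, Inr v}) ` ({..<s} \<times> verts H) :: (nat + 'a) set set"
  have ne: "e \<noteq> {}" if "e \<in> edges H" for e using H that by (auto simp: simple_graph_def)
  have injl: "inj (\<lambda>e. Inl ` e :: (nat + 'a) set)" and injr: "inj (\<lambda>e. Inr ` e :: (nat + 'a) set)"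
    by (auto simp: inj_def inj_image_eq_iff)
  have "card ?A = card (edges (complete_graph s))"
    using injl by (intro card_image) (auto intro: inj_on_subset)
  also have "\<dots> = (s choose 2)" using n_subsets[of "{..<s}" 2] by (simp add: complete_graph_def)
  finally have A: "card ?A = (s choose 2)" .
  have B: "card ?B = card (edges H)"
    using injr by (intro card_image) (auto intro: inj_on_subset)
  have C: "card ?C = s * card (verts H)"
    by (subst card_image) (auto simp: inj_on_def doubleton_eq_iff card_cartesian_product)
  have fin: "finite ?A" "finite ?B" "finite ?C"
    using finite_edges[OF H] finite_edges[OF simple_complete_graph] H by (auto simp: simple_graph_def)
  have ABC: "?A \<inter> ?B = {}" "(?A \<union> ?B) \<inter> ?C = {}"
  proof -
    show "?A \<inter> ?B = {}" using ne by fastforce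
    have "Inl u \<notin> (Inr ` e :: (nat + 'a) set)" "Inr v \<notin> (Inl ` d :: (nat + 'a) set)" for u e v d by auto
    then show "(?A \<union> ?B) \<inter> ?C = {}" by auto
  qed
  have "edges (graph_join (complete_graph s) H) = ?A \<union> ?B \<union> ?C"
    by (auto simp: graph_join_def complete_graph_def)
  then show ?thesis using A B C fin ABC by (simp add: card_Un_disjoint)
qed

lemma simple_disjoint_union:
  assumes "finite I" "\<And>i. i \<in> I \<Longrightarrow> simple_graph (F i)"
  shows "simple_graph (disjoint_union I F)"
proof -
  have "card (Pair i ` e) = card e" for i :: 'a and e :: "'b set"
    by (intro card_image) (auto simp: inj_on_def)
  then show ?thesis using assms by (auto simp: simple_graph_def disjoint_union_def) blast
qed

text \<open>\<open>H\<close> contains none of \<open>F 1\<close>, ..., \<open>F l\<close>, so in a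
  copy of the union each of these \<open>l\<close> graphs would need a vertex of its own among the
  \<open>l - 1\<close> vertices of the clique.\<close>

lemma disjoint_union_free_join:
  assumes simp: "\<And>i. i \<in> {1..h} \<Longrightarrow> simple_graph (F i)" and l: "l \<in> {1..h}"
    and H: "simple_graph H" "\<And>j. j \<in> {1..l} \<Longrightarrow> graph_free (F j) H"
  shows "graph_free (disjoint_union {1..h} F) (graph_join (complete_graph (l - 1)) H)"
proof -
  let ?J = "graph_join (complete_graph (l - 1)) H"
  have U: "simple_graph (disjoint_union {1..h} F)" using simp by (intro simple_disjoint_union) auto
  show ?thesis unfolding graph_free_iff[OF U]
  proof clarify
    fix f assume f: "embedding f (disjoint_union {1..h} F) ?J"
    have inj: "inj_on f (SIGMA i:{1..h}. verts (F i))"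
      using f by (simp add: embedding_def disjoint_union_def)
    have img: "f (i, x) \<in> verts ?J" if "i \<in> {1..h}" "x \<in> verts (F i)" for i x
      using f that by (auto simp: embedding_def disjoint_union_def)
    have edge: "(\<lambda>x. f (i, x)) ` e \<in> edges ?J" if "i \<in> {1..h}" "e \<in> edges (F i)" for i e
    proof -
      have "Pair i ` e \<in> edges (disjoint_union {1..h} F)" 
        using that by (auto simp: disjoint_union_def intro!: bexI[of _ i])
      then have "f ` Pair i ` e \<in> edges ?J" using f unfolding embedding_def by blast
      then show ?thesis by (simp add: image_image)
    qed
    have "\<exists>x\<in>verts (F i). \<exists>y<l - 1. f (i, x) = Inl y" if i: "i \<in> {1..l}" for i
    proof (rule ccontr)
      assume no: "\<not> ?thesis"
      have ih: "i \<in> {1..h}" using i l by auto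
      have inr: "\<exists>y\<in>verts H. f (i, x) = Inr y" if "x \<in> verts (F i)" for x
        using img[OF ih that] no that by (auto simp: graph_join_def complete_graph_def)
      then obtain g where g: "\<And>x. x \<in> verts (F i) \<Longrightarrow> g x \<in> verts H \<and> f (i, x) = Inr (g x)" by metis
      have "embedding g (F i) H"
        unfolding embedding_def
      proof (intro conjI ballI)
        show "inj_on g (verts (F i))"
        proof (rule inj_onI)
          fix x y assume "x \<in> verts (F i)" "y \<in> verts (F i)" "g x = g y"
          then have "f (i, x) = f (i, y)" using g by simp
          then show "x = y" using inj ih \<open>x \<in> verts (F i)\<close> \<open>y \<in> verts (F i)\<close> by (auto simp: inj_on_def)
        qed
        show "g ` verts (F i) \<subseteq> verts H" using g by auto
        fix e assume e: "e \<in> edges (F i)"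
        then have sub: "e \<subseteq> verts (F i)" "e \<noteq> {}" using simp[OF ih] by (auto simp: simple_graph_def)
        then have "(\<lambda>x. f (i, x)) ` e = Inr ` g ` e" unfolding image_image using g by (intro image_cong) auto
        then have "Inr ` g ` e \<in> edges ?J" using edge[OF ih e] by simp
        moreover have "Inr ` g ` e \<noteq> Inl ` d" for d :: "nat set" using sub(2) by auto
        moreover have "Inr ` g ` e \<noteq> {Inl u, Inr v}" for u v by auto
        ultimately obtain d where "d \<in> edges H" "Inr ` g ` e = (Inr ` d :: (nat + _) set)"
          by (auto simp: graph_join_def)
        then show "g ` e \<in> edges H" by (simp add: inj_image_eq_iff)
      qed
      then show False using H(2)[OF i] graph_free_iff[OF simp[OF ih]] by blast
    qed
    then obtain x y where xy: "\<And>i. i \<in> {1..l} \<Longrightarrow> x i \<in> verts (F i) \<and> y i < l - 1 \<and> f (i, x i) = Inl (y i)"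
      by metis
    have "inj_on y {1..l}"
    proof (rule inj_onI)
      fix i j assume ij: "i \<in> {1..l}" "j \<in> {1..l}" "y i = y j"
      then have "f (i, x i) = f (j, x j)" using xy by metis
      moreover have "(i, x i) \<in> (SIGMA i:{1..h}. verts (F i))" "(j, x j) \<in> (SIGMA i:{1..h}. verts (F i))"
        using ij xy l by auto
      ultimately show "i = j" using inj unfolding inj_on_def by blast
    qed
    moreover have "y ` {1..l} \<subseteq> {..<l - 1}" using xy by auto
    ultimately have "card {1..l} \<le> card {..<l - 1}" by (meson card_inj_on_le finite_lessThan)
    moreover have "1 \<le> l" using l by simp
    ultimately show False by simp
  qed
qed

text \<open>The edges meeting \<open>W\<close> are among the pairs of vertices meeting
  \<open>W\<close>. Equal cardinalities force all those pairs to be edges, so \<open>W\<close> is a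
  clique joined to everything else.\<close>

lemma card_edges_split:
  assumes G: "simple_graph G" and W: "W \<subseteq> verts G"
  defines "V \<equiv> verts G" and "s \<equiv> card W"
  shows "card (edges G) \<le> (s choose 2) + s * (card V - s) + card (edges_in G (V - W))"
    and "card (edges G) = (s choose 2) + s * (card V - s) + card (edges_in G (V - W)) \<Longrightarrow>
      graph_iso G (graph_join (complete_graph s) (induced G (V - W)))"
proof -
  have finV: "finite V" "finite W" using G W finite_subset by (auto simp: V_def simple_graph_def)
  let ?P = "{e. e \<subseteq> W \<and> card e = 2}"
  let ?Q = "(\<lambda>(w, v). {w, v}) ` (W \<times> (V - W))"
  have P: "card ?P = (s choose 2)" "finite ?P" using n_subsets[OF finV(2), of 2] finV(2) by (auto simp: s_def)
  have "card ?Q = card (W \<times> (V - W))"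
    by (rule card_image) (auto simp: inj_on_def doubleton_eq_iff)
  then have Q: "card ?Q = s * (card V - s)" "finite ?Q"
    using finV W by (simp_all add: card_cartesian_product card_Diff_subset V_def s_def)
  have PQ: "?P \<inter> ?Q = {}" by auto
  define E2 where "E2 = edges G - edges_in G (V - W)"
  have eV: "e \<subseteq> V" "card e = 2" if "e \<in> edges G" for e using G that by (auto simp: simple_graph_def V_def)
  have sub: "E2 \<subseteq> ?P \<union> ?Q"
  proof
    fix e assume "e \<in> E2"
    then have e: "e \<subseteq> V" "card e = 2" "\<not> e \<subseteq> V - W" using eV by (auto simp: E2_def edges_in_def)
    then obtain w where w: "w \<in> e" "w \<in> W" by auto
    then obtain v where v: "e = {w, v}" "v \<noteq> w" using e(2) by (auto simp: card_2_iff)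
    show "e \<in> ?P \<union> ?Q"
      using e v w by (cases "v \<in> W") auto
  qed
  have cardPQ: "card (?P \<union> ?Q) = (s choose 2) + s * (card V - s)"
    using P Q PQ by (simp add: card_Un_disjoint)
  have finE: "finite (edges G)" by (rule finite_edges[OF G])
  have split: "edges G = E2 \<union> edges_in G (V - W)" by (auto simp: E2_def edges_in_def)
  then have cE: "card (edges G) = card E2 + card (edges_in G (V - W))"
    using finE by (metis E2_def Diff_disjoint Int_commute card_Un_disjoint finite_Un)
  have "card E2 \<le> card (?P \<union> ?Q)" using sub P Q by (intro card_mono) auto
  then show "card (edges G) \<le> (s choose 2) + s * (card V - s) + card (edges_in G (V - W))"
    using cE cardPQ by simp
  assume "card (edges G) = (s choose 2) + s * (card V - s) + card (edges_in G (V - W))"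
  then have "card E2 = card (?P \<union> ?Q)" using cE cardPQ by simp
  then have E2: "E2 = ?P \<union> ?Q" using sub P Q by (intro card_subset_eq) auto
  have edges: "edges G = ?P \<union> ?Q \<union> edges_in G (V - W)" using split unfolding E2 .
  obtain b where b: "bij_betw b W {..<s}"
    using finV(2) s_def ex_bij_betw_finite_nat by (metis atLeast0LessThan)
  define f where "f x = (if x \<in> W then Inl (b x) else Inr x)" for x
  have injb: "inj_on b W" and imgb: "b ` W = {..<s}" using b by (auto simp: bij_betw_def)
  have "bij_betw f V ({..<s} <+> (V - W))"
    unfolding bij_betw_def
  proof
    show "inj_on f V" using injb by (auto simp: f_def inj_on_def)
    show "f ` V = {..<s} <+> (V - W)"
    proof -
      have "f ` V = f ` W \<union> f ` (V - W)" using W by (auto simp: V_def)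
      moreover have "f ` W = Inl ` b ` W" unfolding image_image by (intro image_cong) (auto simp: f_def)
      moreover have "f ` (V - W) = Inr ` (V - W)" by (intro image_cong) (auto simp: f_def)
      ultimately show ?thesis by (simp add: imgb Plus_def)
    qed
  qed
  moreover have "(\<lambda>e. f ` e) ` edges G = edges (graph_join (complete_graph s) (induced G (V - W)))"
  proof -
    have fW: "f ` e = Inl ` b ` e" if "e \<subseteq> W" for e
      unfolding image_image using that by (intro image_cong) (auto simp: f_def)
    have fV: "f ` e = Inr ` e" if "e \<subseteq> V - W" for e
      using that by (intro image_cong) (auto simp: f_def)
    have "(\<lambda>e. f ` e) ` ?P = (\<lambda>e. Inl ` e) ` {e. e \<subseteq> {..<s} \<and> card e = 2}"
    proof -
      have "(\<lambda>e. f ` e) ` ?P = (\<lambda>e. Inl ` e) ` (\<lambda>e. b ` e) ` ?P"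
        unfolding image_image[of _ _ ?P] using fW by (intro image_cong) auto
      also have "(\<lambda>e. b ` e) ` ?P = {e. e \<subseteq> {..<s} \<and> card e = 2}"
      proof
        show "(\<lambda>e. b ` e) ` ?P \<subseteq> {e. e \<subseteq> {..<s} \<and> card e = 2}"
          using imgb injb by (auto simp: card_image inj_on_subset)
        show "{e. e \<subseteq> {..<s} \<and> card e = 2} \<subseteq> (\<lambda>e. b ` e) ` ?P"
        proof clarify
          fix e assume e: "e \<subseteq> {..<s}" "card e = 2"
          then obtain d where d: "d \<subseteq> W" "e = b ` d" unfolding imgb[symmetric] by (meson subset_imageE)
          then have "card d = 2" using e(2) injb by (metis card_image inj_on_subset)
          then show "e \<in> (\<lambda>e. b ` e) ` ?P" using d by blast
        qed
      qed
      finally show ?thesis .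
    qed
    moreover have "(\<lambda>e. f ` e) ` ?Q = {{Inl u, Inr v} | u v. u \<in> {..<s} \<and> v \<in> V - W}"
    proof -
      have "(\<lambda>e. f ` e) ` ?Q = (\<lambda>(w, v). {Inl (b w), Inr v}) ` (W \<times> (V - W))"
        unfolding image_image by (intro image_cong) (auto simp: f_def)
      also have "\<dots> = {{Inl u, Inr v} | u v. u \<in> b ` W \<and> v \<in> V - W}" by auto
      finally show ?thesis unfolding imgb .
    qed
    moreover have "(\<lambda>e. f ` e) ` edges_in G (V - W) = (\<lambda>e. Inr ` e) ` edges_in G (V - W)"
      by (intro image_cong refl fV) (auto simp: edges_in_def)
    ultimately show ?thesis
      unfolding edges image_Un by (auto simp: graph_join_def complete_graph_def induced_def)
  qed
  ultimately show "graph_iso G (graph_join (complete_graph s) (induced G (V - W)))"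
    unfolding graph_iso_def
    by (intro exI[of _ f]) (auto simp: graph_join_def complete_graph_def induced_def V_def)
qed

section \<open>Vertex-disjoint families of copies and their greedy completion\<close>

definition cover :: "(nat \<Rightarrow> 'f graph) \<Rightarrow> nat set \<Rightarrow> (nat \<Rightarrow> 'f \<Rightarrow> 'a) \<Rightarrow> 'a set" where
  "cover F I f = (\<Union>i\<in>I. f i ` verts (F i))"

definition packing :: "(nat \<Rightarrow> 'f graph) \<Rightarrow> nat set \<Rightarrow> (nat \<Rightarrow> 'f \<Rightarrow> 'a) \<Rightarrow> 'a graph \<Rightarrow> bool" where
  "packing F I f G \<longleftrightarrow> (\<forall>i\<in>I. embedding (f i) (F i) G) \<and>
     (\<forall>i\<in>I. \<forall>j\<in>I. i \<noteq> j \<longrightarrow> f i ` verts (F i) \<inter> f j ` verts (F j) = {})"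

lemma packing_insert:
  assumes "packing F I f G" "i \<notin> I" "embedding g (F i) G" "g ` verts (F i) \<inter> cover F I f = {}"
  shows "packing F (insert i I) (f(i := g)) G"
    and "cover F (insert i I) (f(i := g)) = g ` verts (F i) \<union> cover F I f"
proof -
  have f': "(f(i := g)) j = f j" if "j \<in> I" for j using assms(2) that by auto
  have "g ` verts (F i) \<inter> f j ` verts (F j) = {}" if "j \<in> I" for j
    using assms(4) that by (auto simp: cover_def)
  then show "packing F (insert i I) (f(i := g)) G"
    using assms(1,3) f' unfolding packing_def by (auto simp: Int_commute)
  show "cover F (insert i I) (f(i := g)) = g ` verts (F i) \<union> cover F I f"
    using f' by (auto simp: cover_def)
qed

lemma packing_embedding:
  assumes "packing F I f G"
  shows "embedding (\<lambda>(i, x). f i x) (disjoint_union I F) G"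
  unfolding embedding_def
proof (intro conjI ballI)
  show "inj_on (\<lambda>(i, x). f i x) (verts (disjoint_union I F))"
  proof (rule inj_onI, clarsimp simp: disjoint_union_def)
    fix i x j y assume ij: "i \<in> I" "x \<in> verts (F i)" "j \<in> I" "y \<in> verts (F j)" "f i x = f j y"
    have "i = j"
    proof (rule ccontr)
      assume "i \<noteq> j"
      then have "f i ` verts (F i) \<inter> f j ` verts (F j) = {}" using assms ij by (auto simp: packing_def)
      then show False using ij by auto
    qed
    moreover have "inj_on (f i) (verts (F i))" using assms ij by (auto simp: packing_def embedding_def)
    ultimately show "i = j \<and> x = y" using ij by (auto simp: inj_on_def)
  qed
  show "(\<lambda>(i, x). f i x) ` verts (disjoint_union I F) \<subseteq> verts G"
    using assms by (force simp: packing_def embedding_def disjoint_union_def)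
  fix e assume "e \<in> edges (disjoint_union I F)"
  then obtain i d where "i \<in> I" "d \<in> edges (F i)" "e = Pair i ` d" by (auto simp: disjoint_union_def)
  then show "(\<lambda>(i, x). f i x) ` e \<in> edges G"
    using assms by (auto simp: packing_def embedding_def image_image)
qed

text \<open>The bound runs over the whole family \<open>J\<close>, so one constant serves all
  subfamilies.\<close>

lemma card_cover_le:
  assumes "finite J" "I \<subseteq> J" "\<And>i. i \<in> J \<Longrightarrow> finite (verts (F i))"
  shows "finite (cover F I f)" "card (cover F I f) \<le> (\<Sum>i\<in>J. card (verts (F i)))"
proof -
  have finI: "finite I" using assms(1,2) finite_subset by blast
  show "finite (cover F I f)" using finI assms(2,3) by (auto simp: cover_def)
  have "card (cover F I f) \<le> (\<Sum>i\<in>I. card (f i ` verts (F i)))"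
    unfolding cover_def by (rule card_UN_le[OF finI])
  also have "\<dots> \<le> (\<Sum>i\<in>I. card (verts (F i)))"
    using assms(2,3) by (intro sum_mono card_image_le) auto
  also have "\<dots> \<le> (\<Sum>i\<in>J. card (verts (F i)))" using assms(1,2) by (intro sum_mono2) auto
  finally show "card (cover F I f) \<le> (\<Sum>i\<in>J. card (verts (F i)))" .
qed

text \<open>Greedy: each \<open>w\<close> hosts one missing graph that avoids the rest of
  \<open>W\<close> and everything covered so far. The former has fewer than \<open>h\<close>
  vertices and the latter at most the order of the union, hence the bound on
  \<open>Z\<close>.\<close>

lemma packing_complete:
  fixes G :: "'a graph"
  assumes "\<And>i. i \<in> {1..h} \<Longrightarrow> finite (verts (F i))"
    and rob: "\<And>w i Z. w \<in> W \<Longrightarrow> i \<in> {1..h} \<Longrightarrow> finite Z \<Longrightarrow>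
      card Z \<le> h + (\<Sum>i\<in>{1..h}. card (verts (F i))) \<Longrightarrow>
      \<exists>g. embedding g (F i) G \<and> g ` verts (F i) \<subseteq> insert w (verts G - Z)"
    and "finite W" "packing F I f G" "I \<subseteq> {1..h}" "W \<inter> cover F I f = {}" "card W + card I = h"
  shows "\<exists>f. packing F {1..h} f G"
  using assms(3-7) rob
proof (induction "card W" arbitrary: W I f)
  case 0
  then have "card I = card {1..h}" by simp
  then have "I = {1..h}" using 0 by (intro card_subset_eq) auto
  then show ?case using 0 by blast
next
  case (Suc k)
  then obtain w where w: "w \<in> W" by fastforce
  let ?W = "W - {w}"
  have cW: "card ?W = k" using Suc.hyps(2) w by simp
  have "card I \<noteq> card {1..h}" using Suc.hyps(2) Suc.prems(5) by simp
  then have "\<not> {1..h} \<subseteq> I" using Suc.prems(3) by (metis subset_antisym)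
  then obtain i where i: "i \<in> {1..h}" "i \<notin> I" by blast
  let ?Z = "?W \<union> cover F I f"
  have cov: "finite (cover F I f)" "card (cover F I f) \<le> (\<Sum>i\<in>{1..h}. card (verts (F i)))"
    using card_cover_le[OF _ Suc.prems(3), of F f] assms(1) by auto
  have "card ?Z \<le> h + (\<Sum>i\<in>{1..h}. card (verts (F i)))"
    using card_Un_le[of ?W "cover F I f"] cov(2) cW Suc.hyps(2) Suc.prems(5) by linarith
  then obtain g where g: "embedding g (F i) G" "g ` verts (F i) \<subseteq> insert w (verts G - ?Z)"
    using Suc.prems(6)[OF w i(1), of ?Z] cov(1) Suc.prems(1) by auto
  have gc: "g ` verts (F i) \<inter> cover F I f = {}" using g(2) w Suc.prems(4) by blast
  show ?case
  proof (rule Suc.hyps(1)[of ?W "insert i I" "f(i := g)"])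
    show "k = card ?W" using cW by simp
    show "packing F (insert i I) (f(i := g)) G"
      using packing_insert(1)[of F I f G i g] Suc.prems(2) i(2) g(1) gc by blast
    show "?W \<inter> cover F (insert i I) (f(i := g)) = {}"
      using packing_insert(2)[of F I f G i g] Suc.prems(2,4) i(2) g gc by blast
    have "finite I" using Suc.prems(3) finite_subset by blast
    then show "card ?W + card (insert i I) = h" using cW i(2) Suc.hyps(2) Suc.prems(5) by simp
  qed (use Suc.prems i in auto)
qed

section \<open>The structure of extremal graphs\<close>

lemma ex_number_growth_iterate:
  fixes F :: "'f graph" and c :: real
  assumes "\<And>N. N \<ge> N0 \<Longrightarrow> ex_number N F + c * N \<le> ex_number (N + 1) F" "0 \<le> c" "N \<ge> N0"
  shows "ex_number N F + k * (c * N) \<le> ex_number (N + k) F"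
proof (induction k)
  case 0
  then show ?case by simp
next
  case (Suc k)
  have "ex_number (N + k) F + c * (N + k) \<le> ex_number (N + k + 1) F"
    using assms(1)[of "N + k"] assms(3) by simp
  moreover have "c * N \<le> c * (N + k)" using assms(2) by (intro mult_left_mono) auto
  moreover have "real (Suc k) * (c * N) = k * (c * N) + c * N" by (simp add: algebra_simps)
  ultimately show ?case using Suc.IH by (simp add: algebra_simps)
qed

text \<open>The final comparison as pure arithmetic, with s = |W|, x the number of covered vertices,
  E1 = ex(n - s - x, \<open>F j\<close>) and E2 = ex(n - s - 1, \<open>F (s + 2)\<close>). Adding
  \<open>low\<close> and \<open>grow\<close>, the coefficient of n is 1 - a - (2x - 1)e \<ge> 1/r -
  2te = 1/(2r), and the remaining terms are at most h^2 + t(h + t).\<close>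

lemma edge_surplus_contradiction:
  fixes n s x a e E1 E2 r t h :: real
  assumes bounds: "0 \<le> s" "s + 1 \<le> h" "1 \<le> x" "x \<le> t" "a = 1 - 1 / r" "2 \<le> r" "0 < e" "e = 1 / (4 * t * r)"
    and low: "(s + 1) * (n - s - 1) + E2 \<le> s * n + x * ((a + e) * n) + E1"
    and grow: "E1 + (x - 1) * ((a - e) * (n - s - x)) \<le> E2"
    and n: "2 * r * (h\<^sup>2 + t * (h + t)) < n"
  shows False
proof -
  define q where "q = 1 / r"
  have r0: "0 < q" "q \<le> 1 / 2" "a = 1 - q" using bounds by (auto simp: q_def field_simps)
  have t1: "1 \<le> t" using bounds by linarith
  have n0: "0 \<le> n"
  proof -
    have "0 \<le> 2 * r * (h\<^sup>2 + t * (h + t))" using bounds t1 by (intro mult_nonneg_nonneg add_nonneg_nonneg) auto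
    then show ?thesis using n by linarith
  qed
  have te: "e * t = q / 4" using bounds t1 by (simp add: q_def field_simps)
  have "e \<le> e * t" using bounds(7) t1 by simp
  then have e1: "e \<le> 1 / 4" using te r0 by linarith
  have ae: "0 \<le> a - e" "a - e \<le> 1" using e1 r0 bounds(7) by linarith+
  have "(x - 1) * (a - e) \<le> x * 1" using ae bounds by (intro mult_mono) auto
  then have "(x - 1) * (a - e) * (s + x) \<le> x * 1 * (s + x)" using bounds by (intro mult_right_mono) auto
  moreover have "(x - 1) * ((a - e) * (n - s - x)) = (x - 1) * (a - e) * n - (x - 1) * (a - e) * (s + x)"
    by (simp add: algebra_simps)
  ultimately have "(s + 1) * (n - s - 1) + (x - 1) * (a - e) * n - x * (s + x) \<le> s * n + x * ((a + e) * n)"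
    using low grow by linarith
  then have "n - (a + (2 * x - 1) * e) * n \<le> (s + 1)\<^sup>2 + x * (s + x)"
    by (simp add: algebra_simps power2_eq_square)
  moreover have "(a + (2 * x - 1) * e) * n \<le> (1 - q / 2) * n"
  proof (rule mult_right_mono)
    have "(2 * x - 1) * e \<le> 2 * t * e" using bounds by (intro mult_right_mono) auto
    moreover have "2 * t * e = q / 2" using te by (simp add: mult.commute)
    ultimately show "a + (2 * x - 1) * e \<le> 1 - q / 2" using r0 by linarith
  qed (rule n0)
  moreover have "(s + 1)\<^sup>2 \<le> h\<^sup>2" using bounds by (intro power_mono) auto
  moreover have "x * (s + x) \<le> t * (h + t)" using bounds by (intro mult_mono) auto
  moreover have "(1 - q / 2) * n = n - n / (2 * r)"
    using bounds(6) by (simp add: q_def field_simps)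
  ultimately have "n / (2 * r) \<le> h\<^sup>2 + t * (h + t)" by linarith
  then have "n \<le> (h\<^sup>2 + t * (h + t)) * (2 * r)" using bounds(6) by (simp add: pos_divide_le_eq)
  then show False using n by (simp add: mult.commute)
qed

text \<open>The extremal graph for \<open>F l\<close> supplied by the ordering is also free of
  \<open>F j\<close>, so it competes for \<open>ex_number N (F j)\<close>.\<close>

lemma ex_number_antimono:
  assumes "properly_ordered h F" "\<And>i. i \<in> {1..h} \<Longrightarrow> simple_graph (F i)"
  shows "\<exists>N0. \<forall>N\<ge>N0. \<forall>l\<in>{1..h}. \<forall>j\<in>{1..l}. ex_number N (F l) \<le> ex_number N (F j)"
proof -
  obtain N0 where N0: "\<And>N l. N \<ge> N0 \<Longrightarrow> l \<in> {1..h} \<Longrightarrow>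
      \<exists>G :: nat graph. G \<in> extremal_graphs N (F l) \<and> (\<forall>j\<in>{1..l}. graph_free (F j) G)"
    using assms(1) unfolding properly_ordered_def eventually_sequentially by blast
  show ?thesis
  proof (intro exI[of _ N0] allI impI ballI)
    fix N l j assume N: "N \<ge> N0" and l: "l \<in> {1..h}" and j: "j \<in> {1..l}"
    obtain G :: "nat graph" where "G \<in> extremal_graphs N (F l)" "graph_free (F j) G"
      using N0[OF N l] j by blast
    moreover have "simple_graph (F j)" using assms(2) l j by auto
    ultimately show "ex_number N (F l) \<le> ex_number N (F j)"
      using card_edges_le_ex_number[of "F j" G] by (auto simp: extremal_graphs_def)
  qed
qed

text \<open>The edge hypothesis asks for at least as many edges as each construction has. Extremal
  graphs meet it once the constructions are known to be union-free.\<close>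

lemma union_free_structure:
  fixes F :: "nat \<Rightarrow> 'f graph" and h r :: nat
  assumes h: "h \<ge> 2" and r: "r \<ge> 2"
    and simp: "\<And>i. i \<in> {1..h} \<Longrightarrow> simple_graph (F i)"
    and crit: "\<And>i. i \<in> {1..h} \<Longrightarrow> vertex_critical (F i)"
    and chi: "\<And>i. i \<in> {1..h} \<Longrightarrow> chromatic_number (F i) = r + 1"
    and ord: "properly_ordered h F"
  shows "\<exists>n0. \<forall>G :: 'a graph. simple_graph G \<longrightarrow> n0 \<le> card (verts G) \<longrightarrow>
     graph_free (disjoint_union {1..h} F) G \<longrightarrow>
     (\<forall>l\<in>{1..h}. ((l - 1) choose 2) + (l - 1) * (card (verts G) - l + 1) +
        ex_number (card (verts G) - l + 1) (F l) \<le> card (edges G)) \<longrightarrow>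
     (\<exists>W\<subseteq>verts G. card W < h \<and> graph_free (F (card W + 1)) (induced G (verts G - W)))"
proof -
  define U where "U = disjoint_union {1..h} F"
  have simpU: "simple_graph U" unfolding U_def using simp by (intro simple_disjoint_union) auto
  \<comment> \<open>As the order of the whole union, \<open>t\<close> bounds every
    \<open>F i\<close> and every cover at once.\<close>
  define t where "t = (\<Sum>i\<in>{1..h}. card (verts (F i)))"
  have finF: "finite (verts (F i))" if "i \<in> {1..h}" for i using simp[OF that] by (simp add: simple_graph_def)
  have Ft: "card (verts (F i)) \<le> t" if "i \<in> {1..h}" for i
    unfolding t_def using that by (intro member_le_sum) auto
  have neF: "verts (F i) \<noteq> {}" if "i \<in> {1..h}" for i using crit[OF that] by (auto simp: vertex_critical_def)
  have t: "t \<ge> 1" using Ft[of 1] neF[of 1] finF[of 1] h card_gt_0_iff[of "verts (F 1)"] by auto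
  have cardU: "card (verts U) = t"
    unfolding U_def t_def disjoint_union_def using finF by simp
  \<comment> \<open>Fewer than 2t errors of size \<epsilon>n must stay below half of n/r.\<close>
  define \<epsilon> where "\<epsilon> = 1 / (4 * real t * real r)"
  have tr: "2 \<le> real t * real r" using t r mult_mono[of 1 "real t" 2 "real r"] by simp
  have eps: "0 < \<epsilon>" "\<epsilon> \<le> 1 / 8" using t r tr by (auto simp: \<epsilon>_def field_simps)
  then have eps1: "\<epsilon> \<le> 1" by linarith
  define a where "a = 1 - 1 / real r"
  have a0: "1 / 2 \<le> a" using r by (auto simp: a_def field_simps)
  obtain \<delta> n1 where d: "\<delta> > 0" and n1: "\<And>(G :: 'a graph) V v Z. simple_graph G \<Longrightarrow> finite V \<Longrightarrow> n1 \<le> card V \<Longrightarrow>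
           (1 - 1 / r - \<delta>) * (card V)\<^sup>2 / 2 \<le> card (edges_in G V) \<Longrightarrow>
           \<not> has_multipartite G (Suc r) t V \<Longrightarrow>
           (1 - 1 / r + \<epsilon>) * card V \<le> card (nbrs G v \<inter> V) \<Longrightarrow> finite Z \<Longrightarrow> card Z \<le> h + t \<Longrightarrow>
           has_multipartite G r t (nbrs G v \<inter> V - Z)"
    using high_degree_nbrs_has_multipartite[OF r eps(1) eps1, of t "h + t" t, where 'a = 'a] by blast
  have "\<exists>N0. \<forall>N\<ge>N0. ex_number N (F j) + (1 - 1 / r - \<epsilon>) * N \<le> ex_number (N + 1) (F j)"
    if "j \<in> {1..h}" for j
    using that simp crit chi r eps eps1 by (intro ex_number_growth) auto
  then obtain Ng where Ng: "\<And>j N. j \<in> {1..h} \<Longrightarrow> N \<ge> Ng j \<Longrightarrow>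
      ex_number N (F j) + (a - \<epsilon>) * N \<le> ex_number (N + 1) (F j)" unfolding a_def by metis
  \<comment> \<open>The sum stands in for a maximum of the thresholds.\<close>
  define N2 where "N2 = (\<Sum>j\<in>{1..h}. Ng j)"
  have N2: "Ng j \<le> N2" if "j \<in> {1..h}" for j unfolding N2_def using that by (intro member_le_sum) auto
  obtain N1 where N1: "\<And>N l j. N \<ge> N1 \<Longrightarrow> l \<in> {1..h} \<Longrightarrow> j \<in> {1..l} \<Longrightarrow> ex_number N (F l) \<le> ex_number N (F j)"
    using ex_number_antimono[OF ord simp] by metis
  obtain n2 where n2: "\<And>n. n \<ge> n2 \<Longrightarrow> 4 / \<delta> < real n" using less_of_nat_large by blast
  obtain n3 where n3: "\<And>n. n \<ge> n3 \<Longrightarrow> 2 * real r * ((real h)\<^sup>2 + real t * (real h + real t)) < real n"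
    using less_of_nat_large by blast
  show ?thesis
  proof (intro exI[of _ "n1 + n2 + n3 + N1 + N2 + h + t"] allI impI)
    fix G :: "'a graph"
    assume G: "simple_graph G" and big: "n1 + n2 + n3 + N1 + N2 + h + t \<le> card (verts G)"
      and free: "graph_free (disjoint_union {1..h} F) G"
      and low: "\<forall>l\<in>{1..h}. ((l - 1) choose 2) + (l - 1) * (card (verts G) - l + 1) +
        ex_number (card (verts G) - l + 1) (F l) \<le> card (edges G)"
    define V where "V = verts G"
    define n where "n = card V"
    have finV: "finite V" using G by (simp add: V_def simple_graph_def)
    have big: "n1 + n2 + n3 + N1 + N2 + h + t \<le> n" using big by (simp add: n_def V_def)
    have noU: "\<not> embedding f U G" for f using free graph_free_iff[OF simpU] by (auto simp: U_def)
    have nopack: "\<not> packing F {1..h} f G" for f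
      using noU packing_embedding[of F "{1..h}" f G] by (auto simp: U_def)
    \<comment> \<open>The union is itself (r + 1)-colourable and has \<open>t\<close> vertices, so a
      K_(r+1)(t) would contain it.\<close>
    have noK: "\<not> has_multipartite G (Suc r) t V"
    proof
      assume K: "has_multipartite G (Suc r) t V"
      have "\<exists>c. proper_colouring (F i) (Suc r) c" if "i \<in> {1..h}" for i
        using chromatic_number_colouring[OF simp[OF that]] chi[OF that] by auto
      then obtain c where c: "\<And>i. i \<in> {1..h} \<Longrightarrow> proper_colouring (F i) (Suc r) (c i)" by metis
      have "proper_colouring U (Suc r) (\<lambda>(i, x). c i x)"
        unfolding proper_colouring_def
      proof (intro conjI allI impI)
        show "(\<lambda>(i, x). c i x) ` verts U \<subseteq> {..<Suc r}"
          using c by (fastforce simp: U_def disjoint_union_def proper_colouring_def)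
        fix p q assume "{p, q} \<in> edges U"
        then obtain i e where ie: "i \<in> {1..h}" "e \<in> edges (F i)" "{p, q} = Pair i ` e"
          by (auto simp: U_def disjoint_union_def)
        then have "p \<in> Pair i ` e" "q \<in> Pair i ` e" by blast+
        then obtain x y where xy: "p = (i, x)" "q = (i, y)" by blast
        then have "Pair i ` {x, y} = Pair i ` e" using ie(3) by simp
        then have "e = {x, y}" by (metis inj_image_eq_iff inj_onI prod.inject)
        then show "(case p of (i, x) \<Rightarrow> c i x) \<noteq> (case q of (i, x) \<Rightarrow> c i x)"
          using c[OF ie(1)] ie(2) xy by (auto simp: proper_colouring_def)
      qed
      then show False
        using multipartite_embedding[OF simpU _ _ G, of "Suc r" _ t] K noU cardU by (auto simp: V_def)
    qed
    have dense: "(1 - 1 / r - \<delta>) * (card V)\<^sup>2 / 2 \<le> card (edges_in G V)"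
    proof -
      \<comment> \<open>The construction with l = 1 already gives Turan density.\<close>
      have "1 \<in> {1..h}" using h by simp
      then have "ex_number n (F 1) \<le> card (edges G)"
        using low big h by (force simp: n_def V_def)
      moreover have "(1 - 1 / r) * (real n)\<^sup>2 / 2 - 2 * real n \<le> ex_number n (F 1)"
        using ex_number_ge_turan[OF simp chi, of 1 n] h r by simp
      moreover have "2 * real n \<le> \<delta> * (real n)\<^sup>2 / 2"
      proof -
        have "4 / \<delta> \<le> n" using n2[of n] big by simp
        then have "4 \<le> \<delta> * n" using d by (simp add: field_simps)
        then have "4 * real n \<le> \<delta> * n * n" by (intro mult_right_mono) auto
        then show ?thesis by (simp add: power2_eq_square)
      qed
      moreover have "(1 - 1 / r - \<delta>) * (real n)\<^sup>2 / 2 = (1 - 1 / r) * (real n)\<^sup>2 / 2 - \<delta> * (real n)\<^sup>2 / 2"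
        by (simp add: algebra_simps diff_divide_distrib)
      ultimately have "(1 - 1 / r - \<delta>) * (real n)\<^sup>2 / 2 \<le> card (edges G)" by linarith
      then show ?thesis using G by (simp add: V_def n_def edges_in_verts)
    qed
    define W where "W = {v \<in> V. (a + \<epsilon>) * n \<le> card (nbrs G v \<inter> V)}"
    define s where "s = card W"
    have WV: "W \<subseteq> V" "finite W" using finV by (auto simp: W_def)
    have rob: "\<exists>g. embedding g (F i) G \<and> g ` verts (F i) \<subseteq> insert w (verts G - Z)"
      if "w \<in> W" "i \<in> {1..h}" "finite Z" "card Z \<le> h + (\<Sum>i\<in>{1..h}. card (verts (F i)))" for w i Z
    proof (rule critical_embedding[OF simp crit chi Ft G])
      show "has_multipartite G r t (nbrs G w \<inter> verts G - Z)"
        using n1[OF G finV _ dense noK, of w Z] that big by (simp add: W_def V_def n_def t_def a_def)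
    qed (use that WV in \<open>auto simp: V_def\<close>)
    \<comment> \<open>A packing of h - s or more members that avoids \<open>W\<close> could be
      completed by letting vertices of \<open>W\<close> host the missing graphs.\<close>
    have few: "card I + s < h" if pk: "packing F I f G" "I \<subseteq> {1..h}" "W \<inter> cover F I f = {}" for I f
    proof (rule ccontr)
      assume "\<not> ?thesis"
      moreover have "card I \<le> h" using card_mono[OF _ pk(2)] by simp
      ultimately have "h - card I \<le> card W" by (simp add: s_def)
      then obtain W' where W': "W' \<subseteq> W" "card W' = h - card I"
        by (meson obtain_subset_with_card_n)
      have "\<exists>f. packing F {1..h} f G"
      proof (rule packing_complete[where W = W' and I = I and f = f])
        show "finite W'" using W'(1) WV(2) finite_subset by blast
        show "card W' + card I = h" using W'(2) \<open>card I \<le> h\<close> by simp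
        show "W' \<inter> cover F I f = {}" using W'(1) pk(3) by blast
      qed (use finF rob pk W'(1) in auto)
      then show False using nopack by blast
    qed
    have sh: "s < h" using few[of "{}" undefined] by (simp add: packing_def cover_def)
    have "graph_free (F (s + 1)) (induced G (V - W))"
    proof (rule ccontr)
      assume nf: "\<not> ?thesis"
      have s1: "s + 1 \<in> {1..h}" using sh by simp
      obtain f0 where f0: "embedding f0 (F (s + 1)) G" "f0 ` verts (F (s + 1)) \<subseteq> V - W"
        using nf graph_free_induced_iff[OF simp[OF s1], of "V - W" G] unfolding V_def by blast
      define P where "P = {I. I \<subseteq> {1..h} \<and> s + 1 \<in> I \<and> (\<exists>f. packing F I f G \<and> cover F I f \<subseteq> V - W)}"
      have "finite P" by (rule finite_subset[of _ "Pow {1..h}"]) (auto simp: P_def)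
      moreover have "{s + 1} \<in> P"
        using f0 s1 by (auto simp: P_def packing_def cover_def intro!: exI[of _ "\<lambda>_. f0"])
      ultimately obtain I where I: "I \<in> P" "\<And>J. J \<in> P \<Longrightarrow> I \<subseteq> J \<Longrightarrow> I = J"
        using finite_has_maximal[of P] by auto
      obtain f where f: "I \<subseteq> {1..h}" "s + 1 \<in> I" "packing F I f G" "cover F I f \<subseteq> V - W"
        using I(1) by (auto simp: P_def)
      have cardI: "card I + s < h" using f by (intro few[of I f]) auto
      \<comment> \<open>More than \<open>s\<close> indices are missing from \<open>I\<close>, and s
        + 1 is not among them.\<close>
      have "\<exists>j\<in>{1..h} - I. s + 2 \<le> j"
      proof (rule ccontr)
        assume no: "\<not> ?thesis"
        have "j \<in> {1..s}" if j: "j \<in> {1..h} - I" for j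
        proof -
          have "j \<noteq> s + 1" using f(2) j by auto
          moreover have "\<not> s + 2 \<le> j" using no j by blast
          ultimately show ?thesis using j by auto
        qed
        then have "card ({1..h} - I) \<le> card {1..s}" by (intro card_mono) auto
        moreover have "card ({1..h} - I) = h - card I"
          using f(1) by (subst card_Diff_subset) (auto intro: finite_subset)
        ultimately show False using cardI by simp
      qed
      then obtain j where j: "j \<in> {1..h}" "j \<notin> I" "s + 2 \<le> j" by auto
      define X where "X = cover F I f"
      define x where "x = card X"
      have X: "finite X" "x \<le> t"
        using card_cover_le[OF _ f(1), of F f] finF by (auto simp: X_def x_def t_def)
      have "X \<noteq> {}" using f(2) neF[OF s1] by (auto simp: X_def cover_def)
      then have x1: "1 \<le> x" using X(1) by (simp add: x_def Suc_leI card_gt_0_iff)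
      have XV: "X \<subseteq> V - W" using f(4) by (simp add: X_def)
      have "graph_free (F j) (induced G (V - W - X))"
      proof (rule ccontr)
        assume "\<not> ?thesis"
        then obtain g where g: "embedding g (F j) G" "g ` verts (F j) \<subseteq> V - W - X"
          using graph_free_induced_iff[OF simp[OF j(1)], of "V - W - X" G] unfolding V_def by blast
        have "g ` verts (F j) \<inter> cover F I f = {}" using g(2) by (auto simp: X_def)
        note pi = packing_insert[OF f(3) j(2) g(1) this]
        have "cover F (insert j I) (f(j := g)) \<subseteq> V - W" unfolding pi(2) using g(2) f(4) by blast
        then have "insert j I \<in> P" using pi(1) f(1,2) j(1) unfolding P_def by blast
        then show False using I(2)[of "insert j I"] j(2) by blast
      qed
      then have E1: "card (edges_in G (V - W - X)) \<le> ex_number (n - s - x) (F j)"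
      proof -
        assume fr: "graph_free (F j) (induced G (V - W - X))"
        have "card (V - W - X) = n - s - x"
          using WV X(1) XV finV by (simp add: card_Diff_subset n_def s_def x_def)
        then show ?thesis
          using card_edges_le_ex_number[OF simp[OF j(1)] _ fr] simple_induced[OF G] finV
          by (simp add: induced_def)
      qed
      \<comment> \<open>Vertices of \<open>W\<close> are charged the trivial degree
        \<open>n\<close>; those of \<open>X\<close> lie outside \<open>W\<close> and have degree
        below the threshold that defines it.\<close>
      have "card (edges_in G V) \<le> card (edges_in G (V - W)) + card W * real n"
        using finV by (intro card_edges_in_Diff_le[OF G finV WV(1)]) (auto simp: n_def intro: card_mono)
      moreover have "card (edges_in G (V - W)) \<le> card (edges_in G (V - W - X)) + card X * ((a + \<epsilon>) * n)"
      proof (rule card_edges_in_Diff_le[OF G _ XV])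
        fix y assume "y \<in> X"
        then have "card (nbrs G y \<inter> V) \<le> (a + \<epsilon>) * n" using XV by (auto simp: W_def)
        moreover have "card (nbrs G y \<inter> (V - W)) \<le> card (nbrs G y \<inter> V)" using finV by (intro card_mono) auto
        ultimately show "card (nbrs G y \<inter> (V - W)) \<le> (a + \<epsilon>) * n" by linarith
      qed (use finV in simp)
      ultimately have up: "card (edges G) \<le> s * real n + x * ((a + \<epsilon>) * n) + ex_number (n - s - x) (F j)"
        using E1 G by (simp add: s_def x_def V_def edges_in_verts)
      have nb: "s + x \<le> n" "N2 \<le> n - s - x" "N1 \<le> n - s - 1" using big sh X(2) t by auto
      \<comment> \<open>x - 1 increments lead to order n - s - 1, which is what the construction
        with s + 1 full vertices leaves for its extremal part.\<close>
      have "ex_number (n - s - x) (F j) + real (x - 1) * ((a - \<epsilon>) * real (n - s - x)) \<le>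
          ex_number (n - s - x + (x - 1)) (F j)"
      proof (rule ex_number_growth_iterate[of "Ng j"])
        show "Ng j \<le> n - s - x" using N2[OF j(1)] nb(2) by linarith
      qed (use Ng[OF j(1)] a0 eps in auto)
      moreover have eqs: "n - s - x + (x - 1) = n - s - 1" "real (x - 1) = real x - 1"
          "real (n - s - x) = real n - real s - real x"
        using nb(1) x1 by (auto simp: of_nat_diff)
      moreover have "ex_number (n - s - 1) (F j) \<le> ex_number (n - s - 1) (F (s + 2))"
        using j by (intro N1 nb(3)) auto
      ultimately have grow: "ex_number (n - s - x) (F j) + (real x - 1) * ((a - \<epsilon>) * (real n - real s - real x))
          \<le> ex_number (n - s - 1) (F (s + 2))"
        unfolding eqs by linarith
      have "s + 2 \<in> {1..h}" using j by auto
      then have lw: "((s + 2 - 1) choose 2) + (s + 2 - 1) * (n - (s + 2) + 1) + ex_number (n - (s + 2) + 1) (F (s + 2))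
          \<le> card (edges G)"
        using low unfolding n_def V_def by blast
      have "n - (s + 2) + 1 = n - s - 1" "s + 2 - 1 = s + 1" using big sh j by auto
      note lw = lw[unfolded this]
      then have "real ((s + 1) * (n - s - 1)) + ex_number (n - s - 1) (F (s + 2)) \<le> real (card (edges G))"
        by linarith
      moreover have rn: "real (n - s - 1) = real n - real s - 1" using nb(1) x1 by (simp add: of_nat_diff)
      have "real ((s + 1) * (n - s - 1)) = (real s + 1) * (real n - real s - 1)"
        unfolding of_nat_mult rn by simp
      ultimately have "(real s + 1) * (real n - real s - 1) + ex_number (n - s - 1) (F (s + 2)) \<le> card (edges G)"
        by linarith
      then have lw: "(real s + 1) * (real n - real s - 1) + ex_number (n - s - 1) (F (s + 2)) \<le>
          real s * real n + real x * ((a + \<epsilon>) * real n) + ex_number (n - s - x) (F j)" using up by linarith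
      show False
      proof (rule edge_surplus_contradiction[OF _ _ _ _ a_def _ eps(1) \<epsilon>_def lw grow])
        show "2 * real r * ((real h)\<^sup>2 + real t * (real h + real t)) < real n" using n3 big by simp
      qed (use sh x1 X(2) r in auto)
    qed
    then show "\<exists>W\<subseteq>verts G. card W < h \<and> graph_free (F (card W + 1)) (induced G (verts G - W))"
      using WV(1) sh by (auto simp: s_def V_def)
  qed
qed

theorem theorem3:
  fixes F :: "nat \<Rightarrow> 'f graph" and h r :: nat
  assumes "h \<ge> 2" and "r \<ge> 2"
    and "\<And>i. i \<in> {1..h} \<Longrightarrow> simple_graph (F i)"
    and "\<And>i. i \<in> {1..h} \<Longrightarrow> vertex_critical (F i)"
    and "\<And>i. i \<in> {1..h} \<Longrightarrow> chromatic_number (F i) = r + 1"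
    and "properly_ordered h F"
  shows "\<forall>\<^sub>F n in sequentially.
           ex_number n (disjoint_union {1..h} F) =
             (MAX l\<in>{1..h}.
                ((l - 1) choose 2) + (l - 1) * (n - l + 1) + ex_number (n - l + 1) (F l)) \<and>
           (\<forall>G :: 'a graph. G \<in> extremal_graphs n (disjoint_union {1..h} F) \<longrightarrow>
              (\<exists>l\<in>{1..h}. \<exists>H :: 'a graph.
                 H \<in> extremal_graphs (n - l + 1) (F l) \<and>
                 graph_iso G (graph_join (complete_graph (l - 1)) H)))"
proof -
  define U where "U = disjoint_union {1..h} F"
  define val where "val n l = ((l - 1) choose 2) + (l - 1) * (n - l + 1) + ex_number (n - l + 1) (F l)" for n l
  have simpU: "simple_graph U" unfolding U_def using assms(3) by (intro simple_disjoint_union) auto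
  \<comment> \<open>The structure is needed for two vertex types: the naturals, where
    \<open>ex_number\<close> is attained, and \<open>'a\<close>, for the graphs of the second
    claim.\<close>
  obtain n1 where n1: "\<And>G :: nat graph. simple_graph G \<Longrightarrow> n1 \<le> card (verts G) \<Longrightarrow> graph_free U G \<Longrightarrow>
     (\<forall>l\<in>{1..h}. val (card (verts G)) l \<le> card (edges G)) \<Longrightarrow>
     (\<exists>W\<subseteq>verts G. card W < h \<and> graph_free (F (card W + 1)) (induced G (verts G - W)))"
    using union_free_structure[OF assms, where 'a = nat] unfolding U_def val_def by blast
  obtain n2 where n2: "\<And>G :: 'a graph. simple_graph G \<Longrightarrow> n2 \<le> card (verts G) \<Longrightarrow> graph_free U G \<Longrightarrow>
     (\<forall>l\<in>{1..h}. val (card (verts G)) l \<le> card (edges G)) \<Longrightarrow>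
     (\<exists>W\<subseteq>verts G. card W < h \<and> graph_free (F (card W + 1)) (induced G (verts G - W)))"
    using union_free_structure[OF assms, where 'a = 'a] unfolding U_def val_def by blast
  obtain N0 where N0: "\<And>N l. N \<ge> N0 \<Longrightarrow> l \<in> {1..h} \<Longrightarrow>
      \<exists>G :: nat graph. G \<in> extremal_graphs N (F l) \<and> (\<forall>j\<in>{1..l}. graph_free (F j) G)"
    using assms(6) unfolding properly_ordered_def eventually_sequentially by blast
  \<comment> \<open>Both inequalities behind the bound, one for the edges at \<open>W\<close> and
    one for the edges outside, must be tight in case of equality; this gives the join and the
    extremality of the rest.\<close>
  have upper: "card (edges G) \<le> val n (s + 1)"
    "card (edges G) = val n (s + 1) \<Longrightarrow> induced G (verts G - W) \<in> extremal_graphs (n - (s + 1) + 1) (F (s + 1)) \<and>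
        graph_iso G (graph_join (complete_graph s) (induced G (verts G - W)))"
    if "simple_graph G" "card (verts G) = n" "h \<le> n" "W \<subseteq> verts G" "card W = s" "s < h"
      "graph_free (F (s + 1)) (induced G (verts G - W))" for G :: "'b graph" and W s n
  proof -
    have fin: "finite (verts G)" "finite W"
      using that(1,4) finite_subset by (auto simp: simple_graph_def)
    have si: "simple_graph (induced G (verts G - W))" using that(1) fin(1) by (intro simple_induced) auto
    have cv: "card (verts (induced G (verts G - W))) = n - s"
      using fin that by (simp add: induced_def card_Diff_subset)
    have ns: "n - (s + 1) + 1 = n - s" using that(3,6) by simp
    have "simple_graph (F (s + 1))" using assms(3) that(6) by simp
    then have ex: "card (edges_in G (verts G - W)) \<le> ex_number (n - s) (F (s + 1))"
      using card_edges_le_ex_number[OF _ si that(7)] cv by (simp add: induced_def)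
    note split = card_edges_split[OF that(1,4), unfolded that(2,5)]
    have val: "val n (s + 1) = (s choose 2) + s * (n - s) + ex_number (n - s) (F (s + 1))"
      by (simp only: val_def ns add_diff_cancel_right')
    show "card (edges G) \<le> val n (s + 1)" using split(1) ex val by linarith
    assume eq: "card (edges G) = val n (s + 1)"
    have "card (edges_in G (verts G - W)) = ex_number (n - s) (F (s + 1))"
      using split(1) ex eq val by linarith
    then show "induced G (verts G - W) \<in> extremal_graphs (n - (s + 1) + 1) (F (s + 1)) \<and>
        graph_iso G (graph_join (complete_graph s) (induced G (verts G - W)))"
      using split(2) eq[unfolded val] si cv that(7) unfolding ns by (simp add: extremal_graphs_def induced_def)
  qed
  have "ex_number n U = (MAX l\<in>{1..h}. val n l) \<and>
      (\<forall>G :: 'a graph. G \<in> extremal_graphs n U \<longrightarrow> (\<exists>l\<in>{1..h}. \<exists>H :: 'a graph.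
         H \<in> extremal_graphs (n - l + 1) (F l) \<and> graph_iso G (graph_join (complete_graph (l - 1)) H)))"
    \<comment> \<open>The summand \<open>h\<close> makes the natural number subtraction in
      \<open>n - l + 1\<close> exact and keeps this order above \<open>N0\<close>.\<close>
    if n: "n1 + n2 + N0 + h \<le> n" for n
  proof -
    have lower: "\<exists>G :: (nat + nat) graph. simple_graph G \<and> card (verts G) = n \<and> graph_free U G \<and> card (edges G) = val n l"
      if l: "l \<in> {1..h}" for l
    proof -
      have "n - l + 1 \<ge> N0" using n l by auto
      then obtain H :: "nat graph" where H: "H \<in> extremal_graphs (n - l + 1) (F l)" "\<forall>j\<in>{1..l}. graph_free (F j) H"
        using N0 l by blast
      then have sH: "simple_graph H" "card (verts H) = n - l + 1" "card (edges H) = ex_number (n - l + 1) (F l)"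
        by (auto simp: extremal_graphs_def)
      let ?G = "graph_join (complete_graph (l - 1)) H"
      have "card (verts ?G) = n"
        using card_verts_join[OF simple_complete_graph sH(1)] sH(2) l n by (simp add: complete_graph_def)
      moreover have "card (edges ?G) = val n l" using card_edges_join_complete[OF sH(1)] sH by (simp add: val_def)
      moreover have "graph_free U ?G"
        unfolding U_def using assms(3) l sH(1) H(2) by (intro disjoint_union_free_join) auto
      ultimately show ?thesis using simple_graph_join[OF simple_complete_graph sH(1)] by blast
    qed
    have ge: "val n l \<le> ex_number n U" if "l \<in> {1..h}" for l
      using lower[OF that] card_edges_le_ex_number[OF simpU] by metis
    have one: "1 \<in> {1..h}" using assms(1) by simp
    obtain G0 :: "nat graph" where "G0 \<in> extremal_graphs n U"
      using lower[OF one] ex_number_attained[OF simpU] by metis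
    then have G0: "simple_graph G0" "card (verts G0) = n" "graph_free U G0" "card (edges G0) = ex_number n U"
      by (auto simp: extremal_graphs_def)
    \<comment> \<open>By \<open>ge\<close> an extremal graph has at least as many edges as every
      construction, as the structure result requires.\<close>
    obtain W where W: "W \<subseteq> verts G0" "card W < h" "graph_free (F (card W + 1)) (induced G0 (verts G0 - W))"
      using n1[OF G0(1) _ G0(3)] G0 ge n by auto
    have le: "ex_number n U \<le> val n (card W + 1)"
      using upper(1)[OF G0(1,2) _ W(1) refl W(2,3)] G0(4) n by simp
    have max: "ex_number n U = (MAX l\<in>{1..h}. val n l)"
    proof (rule sym, rule Max_eqI)
      show "ex_number n U \<in> val n ` {1..h}"
        using le ge[of "card W + 1"] W(2) by (intro image_eqI[of _ _ "card W + 1"]) auto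
    qed (use ge in auto)
    have "\<exists>l\<in>{1..h}. \<exists>H :: 'a graph. H \<in> extremal_graphs (n - l + 1) (F l) \<and>
        graph_iso G (graph_join (complete_graph (l - 1)) H)" if "G \<in> extremal_graphs n U" for G :: "'a graph"
    proof -
      have G: "simple_graph G" "card (verts G) = n" "graph_free U G" "card (edges G) = ex_number n U"
        using that by (auto simp: extremal_graphs_def)
      obtain W where W: "W \<subseteq> verts G" "card W < h" "graph_free (F (card W + 1)) (induced G (verts G - W))"
        using n2[OF G(1) _ G(3)] G ge n by auto
      have hn: "h \<le> n" using n by simp
      have "card (edges G) = val n (card W + 1)"
        using upper(1)[OF G(1,2) hn W(1) refl W(2,3)] ge[of "card W + 1"] G(4) W(2) by simp
      from upper(2)[OF G(1,2) hn W(1) refl W(2,3) this] show ?thesis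
        using W(2) by (intro bexI[of _ "card W + 1"] exI[of _ "induced G (verts G - W)"]) auto
    qed
    then show ?thesis using max by blast
  qed
  then show ?thesis unfolding eventually_sequentially U_def val_def by blast
qed

end
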